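(* Let $q\ge 7$, $q\not\in\{8,10,12,24\}$. There is a set $D\subset F_q^*\setminus\{1\}$ with $|D|=3$ such that for any $\tau>0$ there is a system $\mathcal B$ modulo $q$ with $|\mathcal B|\le 34$, in which each sequence $B(\chi)$ consists of numbers with imaginary part $>\tau$, and which is a barrier for both of the following statements about a family $\mathcal F=(F_{q,a})_{a\in F_q^*}$: (1) for arbitrarily large $x$, $F_{q,1}(x)<F_{q,a}(x)$ for all $a\in D$; (2) for arbitrarily large $x$, $F_{q,1}(x)>F_{q,a}(x)$ for all $a\in D$.
   Context: Let $q\ge 3$ be an integer, $F_q^*$ the multiplicative group of reduced residues modulo $q$, $\phi$ Euler's function, $C_q$ the set of non-principal Dirichlet characters modulo $q$, $\pi(x)$ the number of primes $\le x$. For complex $\rho$ with $\Re\rho>0$ and $x\ge 2$ put $$f(\rho)=\frac{x^{\rho}}{\rho\log x}+\frac1\rho\int_2^x\frac{t^\rho}{t\log^2 t}\,dt .$$ A system $\mathcal B$ (modulo $q$) assigns to each $\chi\in C_q$ a sequence $B(\chi)$ (possibly empty, repetitions allowed) of complex numbers with non-negative imaginary part; $n(\rho,\chi)$ is the number of occurrences of $\rho$ in $B(\chi)$ (0 if it does not occur). If $\rho$ is real it is required that $n(\rho,\chi)=n(\rho,\overline\chi)$. Put $R^+(\mathcal B)=\sup\{\Re\rho:\rho\in\mathcal B\}$, $R^-(\mathcal B)=\inf\{\Re\rho:\rho\in\mathcal B\}$. It is always assumed that $\frac12<R^-(\mathcal B)\le R^+(\mathcal B)\le 1$ and $\sum_{\chi\in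 C_q}\sum_{\rho\in B(\chi)} n(\rho,\chi)/|\rho|<\infty$ (sums are over distinct $\rho$). Define $$P_{q,a}(x;\mathcal B)=-\frac{2}{\phi(q)}\Re\Big(\sum_{\chi\in C_q}\overline\chi(a)\sum_{\rho\in B(\chi)}w(\rho)\,n(\rho,\chi) f(\rho)\Big)+\frac{\pi(x)}{\phi(q)},$$ where the inner sum is over distinct $\rho$, $w(\rho)=\frac12$ if $\rho$ is real and $w(\rho)=1$ otherwise. A family $\mathcal F=(F_{q,a})_{a\in F_q^*}$ of functions $[0,\infty)\to\mathbb R$ is $\beta$-similar to $\mathcal P_q=(P_{q,a}(\cdot;\mathcal B))_{a\in F_q^*}$ if $|F_{q,a}(x)-P_{q,a}(x;\mathcal B)|=o(x^\beta/\log x)$ as $x\to\infty$ for every $a$. For a statement $\mathcal I(\mathcal F)$ about such families, $\mathcal B$ is a barrier for $\mathcal I$ if, with $\beta=R^-(\mathcal B)$, for every $\mathcal F$ that is $\beta$-similar to $\mathcal P_q$ the statement $\mathcal I(\mathcal F)$ is false. If all $B(\chi)$ are finite, $|\mathcal B|$ is the total number of elements of the sequences $B(\chi)$, $\chi\in C_q$, counted with multiplicity. "For arbitrarily large $x$, $A(x)$" means the set of $x$ for which $A(x)$ holds is unbounded above. *)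

theory Defs
  imports
    "HOL-Analysis.Analysis"
    "HOL-Number_Theory.Totient"
    "HOL-Library.Landau_Symbols"
begin

definition dirichlet_character :: "nat \<Rightarrow> (nat \<Rightarrow> complex) \<Rightarrow> bool" where
  "dirichlet_character q chi \<longleftrightarrow>
     (\<forall>a b. chi (a * b) = chi a * chi b) \<and>
     (\<forall>a. chi (a + q) = chi a) \<and>
     (\<forall>a. chi a \<noteq> 0 \<longleftrightarrow> coprime a q)"

definition principal_character :: "nat \<Rightarrow> nat \<Rightarrow> complex" where
  "principal_character q a = (if coprime a q then 1 else 0)"

definition nonprincipal_characters :: "nat \<Rightarrow> (nat \<Rightarrow> complex) set" where
  "nonprincipal_characters q = {chi. dirichlet_character q chi \<and> chi \<noteq> principal_character q}"

definition conj_character :: "(nat \<Rightarrow> complex) \<Rightarrow> nat \<Rightarrow> complex" where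
  "conj_character chi a = cnj (chi a)"

definition prime_count :: "real \<Rightarrow> nat" where
  "prime_count x = card {p::nat. prime p \<and> real p \<le> x}"

datatype 'a finf_seq = Fin_Seq "'a list" | Inf_Seq "nat \<Rightarrow> 'a"

primrec seq_elems :: "'a finf_seq \<Rightarrow> 'a set" where
  "seq_elems (Fin_Seq xs) = set xs"
| "seq_elems (Inf_Seq s) = range s"

(* Infinitely many occurrences are counted as 0; is_system excludes that case. *)
primrec seq_count :: "'a finf_seq \<Rightarrow> 'a \<Rightarrow> nat" where
  "seq_count (Fin_Seq xs) z = count_list xs z"
| "seq_count (Inf_Seq s) z = card {i. s i = z}"

primrec finite_multiplicities :: "'a finf_seq \<Rightarrow> bool" where
  "finite_multiplicities (Fin_Seq xs) \<longleftrightarrow> True"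
| "finite_multiplicities (Inf_Seq s) \<longleftrightarrow> (\<forall>z. finite {i. s i = z})"

primrec seq_finite :: "'a finf_seq \<Rightarrow> bool" where
  "seq_finite (Fin_Seq xs) \<longleftrightarrow> True"
| "seq_finite (Inf_Seq s) \<longleftrightarrow> False"

(* Meaningful for finite sequences only; the value 0 on infinite ones is junk. *)
primrec seq_length :: "'a finf_seq \<Rightarrow> nat" where
  "seq_length (Fin_Seq xs) = length xs"
| "seq_length (Inf_Seq s) = 0"

(* Only the values at non-principal characters modulo q are relevant. *)
type_synonym zero_system = "(nat \<Rightarrow> complex) \<Rightarrow> complex finf_seq"

definition system_elems :: "nat \<Rightarrow> zero_system \<Rightarrow> complex set" where
  "system_elems q B = (\<Union>chi\<in>nonprincipal_characters q. seq_elems (B chi))"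

(* Extended reals make the bounds required in is_system correct for unbounded and empty
   systems too: the empty system has R_minus = \<infinity> and R_plus = -\<infinity>, hence is excluded. *)
definition R_plus :: "nat \<Rightarrow> zero_system \<Rightarrow> ereal" where
  "R_plus q B = (SUP \<rho>\<in>system_elems q B. ereal (Re \<rho>))"

definition R_minus :: "nat \<Rightarrow> zero_system \<Rightarrow> ereal" where
  "R_minus q B = (INF \<rho>\<in>system_elems q B. ereal (Re \<rho>))"

(* Finiteness of the multiplicities is part of the convergence of the sum
   of n(\<rho>,chi)/|\<rho>|; it is spelled out because seq_count is a natural number. *)
definition is_system :: "nat \<Rightarrow> zero_system \<Rightarrow> bool" where
  "is_system q B \<longleftrightarrow>
     (\<forall>\<rho>\<in>system_elems q B. Im \<rho> \<ge> 0) \<and>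
     (\<forall>chi\<in>nonprincipal_characters q. \<forall>\<rho>. Im \<rho> = 0 \<longrightarrow>
        seq_count (B chi) \<rho> = seq_count (B (conj_character chi)) \<rho>) \<and>
     1 / 2 < R_minus q B \<and> R_minus q B \<le> R_plus q B \<and> R_plus q B \<le> 1 \<and>
     (\<forall>chi\<in>nonprincipal_characters q. finite_multiplicities (B chi)) \<and>
     (\<lambda>(chi, \<rho>). real (seq_count (B chi) \<rho>) / norm \<rho>) summable_on
        (SIGMA chi:nonprincipal_characters q. seq_elems (B chi))"

definition finite_system :: "nat \<Rightarrow> zero_system \<Rightarrow> bool" where
  "finite_system q B \<longleftrightarrow> (\<forall>chi\<in>nonprincipal_characters q. seq_finite (B chi))"

definition system_size :: "nat \<Rightarrow> zero_system \<Rightarrow> nat" where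
  "system_size q B = (\<Sum>chi\<in>nonprincipal_characters q. seq_length (B chi))"

definition zero_term :: "real \<Rightarrow> complex \<Rightarrow> complex" where
  "zero_term x \<rho> =
     of_real x powr \<rho> / (\<rho> * of_real (ln x)) +
     1 / \<rho> * integral {2..x} (\<lambda>t. of_real t powr \<rho> / of_real (t * (ln t)\<^sup>2))"

definition zero_weight :: "complex \<Rightarrow> real" where
  "zero_weight \<rho> = (if Im \<rho> = 0 then 1 / 2 else 1)"

definition P_fun :: "nat \<Rightarrow> zero_system \<Rightarrow> nat \<Rightarrow> real \<Rightarrow> real" where
  "P_fun q B a x =
     - (2 / real (totient q)) *
       Re (\<Sum>chi\<in>nonprincipal_characters q. conj_character chi a *
             (\<Sum>\<^sub>\<infinity>\<rho>\<in>seq_elems (B chi).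
                of_real (zero_weight \<rho>) * of_nat (seq_count (B chi) \<rho>) * zero_term x \<rho>))
     + real (prime_count x) / real (totient q)"

(* A family indexed by the reduced residues modulo q; only the values F a x
   with a in totatives q and x \<ge> 0 are relevant. *)
type_synonym residue_family = "nat \<Rightarrow> real \<Rightarrow> real"

definition similar :: "nat \<Rightarrow> real \<Rightarrow> residue_family \<Rightarrow> residue_family \<Rightarrow> bool" where
  "similar q \<beta> F P \<longleftrightarrow>
     (\<forall>a\<in>totatives q. (\<lambda>x. \<bar>F a x - P a x\<bar>) \<in> o[at_top](\<lambda>x. x powr \<beta> / ln x))"

definition barrier :: "nat \<Rightarrow> zero_system \<Rightarrow> (residue_family \<Rightarrow> bool) \<Rightarrow> bool" where
  "barrier q B \<I> \<longleftrightarrow>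
     (\<forall>F. similar q (real_of_ereal (R_minus q B)) F (P_fun q B) \<longrightarrow> \<not> \<I> F)"

definition for_arbitrarily_large :: "(real \<Rightarrow> bool) \<Rightarrow> bool" where
  "for_arbitrarily_large A \<longleftrightarrow> \<not> bdd_above {x. x \<ge> 0 \<and> A x}"

end

theory Submission
  imports Defs "HOL-Number_Theory.Residues" "HOL-Real_Asymp.Real_Asymp"
begin

text \<open>
  All zeros are put on the line with real part \<open>3 / 4\<close>, at heights that are multiples \<open>k * \<gamma>\<close> of one
  large number \<open>\<gamma>\<close>. Divided by \<open>x powr (3 / 4) / ln x\<close>, the function for the residue 1 minus the one for
  \<open>a\<close> is then, up to \<open>o(1)\<close> and a positive factor, the real part of a polynomial in the point
  \<open>w = cis (\<gamma> * ln x)\<close> of the unit circle. As \<open>\<gamma>\<close> grows, \<open>\<gamma> / \<rho>\<close> approaches \<open>1 / (\<i> * k)\<close> for the zero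
  \<open>\<rho>\<close> at height \<open>k * \<gamma>\<close>. Hence \<open>\<gamma>\<close> times this real part approaches a limit that depends on \<open>w\<close> alone, to
  which such a zero, attached to the character \<open>\<chi>\<close>, contributes the imaginary part of
  \<open>(cnj (\<chi> a) - 1) * w ^ k / k\<close>. If at each point \<open>w\<close> of the circle these limits take both signs as \<open>a\<close>
  runs through \<open>D\<close>, then compactness makes this uniform, and it survives all errors
  (\<open>harmonic_system_barrier\<close>).

  Two characters \<open>\<chi>\<close> and \<open>\<psi>\<close> and three residues suffice. The residue \<open>a1\<close> satisfies \<open>\<chi> a1 = 1\<close> and
  \<open>\<psi> a1 = -1\<close>; the residues \<open>a2\<close> and \<open>a3\<close> are inverse to each other, and the argument of \<open>\<chi> a2\<close> is
  at most 120 degrees in absolute value. The character \<open>\<chi>\<close> gets zeros at the height \<open>\<gamma>\<close> only. For \<open>a2\<close> and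
  \<open>a3\<close> they produce two sine waves with complex conjugate
  amplitudes; their signs are opposite except when \<open>w\<close> is within 60 degrees of \<open>\<i>\<close>, where both may be
  negative, or of \<open>- \<i>\<close>, where both may be positive, because \<open>Re (cnj (\<chi> a) - 1) \<le> 0\<close>. On these two arcs
  \<open>a1\<close>, for which \<open>\<chi>\<close> contributes nothing, has to take the opposite sign. The character \<open>\<psi>\<close> achieves
  this with zeros at the heights \<open>3 * \<gamma>\<close>, ..., \<open>11 * \<gamma>\<close>, with multiplicities for which the weighted sum of
  sines is negative on the whole arc around \<open>\<i>\<close> (\<open>Im_odd_harmonics_neg\<close>, \<open>race_gap_pos\<close>). Complex
  conjugation of \<open>w\<close> exchanges the two signs (\<open>race_gap_neg\<close>). If \<open>\<psi> a2 \<noteq> 1\<close>, these zeros also disturb the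
  two sine waves; the zeros of \<open>\<chi>\<close> are taken with a multiplicity that outweighs this when
  \<open>(\<chi> a2)\<^sup>2 = -1\<close>. Altogether this takes 24 zeros.

  Such residues and characters exist (\<open>race_configuration\<close>). If some unit modulo \<open>q\<close> has an order that is
  not a power of two, elements of odd order and of order two can be treated independently. Otherwise
  the orders of all units are powers of two; outside the exceptional moduli there are more than four units,
  and not all of them have order at most two, which makes room for \<open>\<chi> a2 = \<plusminus>\<i>\<close>. The characters come from
  extending characters of subgroups (\<open>dirichlet_character_separates\<close>).
\<close>

section \<open>Characters of subgroups of the units modulo a number\<close>

text \<open>
  A character of a subgroup of the units modulo \<open>q\<close>, given by its graph. The last condition alone
  makes the relation single-valued, because it is a group; working with graphs thus avoids all
  well-definedness arguments when a character is extended.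
\<close>
definition partial_character :: "nat \<Rightarrow> (nat \<times> complex) set \<Rightarrow> bool" where
  "partial_character q R \<longleftrightarrow>
     (\<forall>a z. (a, z) \<in> R \<longrightarrow> coprime a q) \<and>
     (1, 1) \<in> R \<and>
     (\<forall>a z b w. (a, z) \<in> R \<longrightarrow> (b, w) \<in> R \<longrightarrow> (a * b, z * w) \<in> R) \<and>
     (\<forall>a b z. (a, z) \<in> R \<longrightarrow> [a = b] (mod q) \<longrightarrow> (b, z) \<in> R) \<and>
     (\<forall>z. (1, z) \<in> R \<longrightarrow> z = 1)"

lemma partial_characterD:
  assumes "partial_character q R"
  shows "(a, z) \<in> R \<Longrightarrow> coprime a q"
    and "(1, 1) \<in> R"
    and "(a, z) \<in> R \<Longrightarrow> (b, w) \<in> R \<Longrightarrow> (a * b, z * w) \<in> R"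
    and "(a, z) \<in> R \<Longrightarrow> [a = b] (mod q) \<Longrightarrow> (b, z) \<in> R"
    and "(1, z) \<in> R \<Longrightarrow> z = 1"
  using assms unfolding partial_character_def by blast+

lemma partial_character_power:
  assumes "partial_character q R" "(a, z) \<in> R"
  shows "(a ^ n, z ^ n) \<in> R"
proof (induction n)
  case (Suc n)
  then show ?case using partial_characterD(3)[OF assms(1) assms(2)] by simp
qed (use partial_characterD(2)[OF assms(1)] in simp)

lemma partial_character_root_of_unity:
  assumes "partial_character q R" "(a, z) \<in> R"
  shows "z ^ totient q = 1"
proof -
  have "[a ^ totient q = 1] (mod q)"
    using euler_theorem partial_characterD(1)[OF assms] by blast
  then show ?thesis
    using partial_characterD(4,5)[OF assms(1)] partial_character_power[OF assms] by blast
qed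

text \<open>
  The inverse in the finite group of units is a power, so closure under products suffices.
\<close>
lemma partial_character_inverse:
  assumes q: "q > 0" and R: "partial_character q R" and a: "(a, z) \<in> R"
  obtains b w where "(b, w) \<in> R" "[a * b = 1] (mod q)" "z * w = 1"
proof -
  have *: "x * x ^ (totient q - 1) = x ^ totient q" for x :: "'b :: monoid_mult"
    using q by (metis power_eq_if totient_0_iff neq0_conv)
  have "[a * a ^ (totient q - 1) = 1] (mod q)"
    unfolding * using euler_theorem partial_characterD(1)[OF R a] by blast
  moreover have "z * z ^ (totient q - 1) = 1"
    unfolding * by (rule partial_character_root_of_unity[OF R a])
  ultimately show thesis
    using that partial_character_power[OF R a] by blast
qed

lemma partial_character_unique:
  assumes q: "q > 0" and R: "partial_character q R" and "(a, z) \<in> R" "(a, z') \<in> R"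
  shows "z = z'"
proof -
  obtain b w where b: "(b, w) \<in> R" "[a * b = 1] (mod q)" "z * w = 1"
    using partial_character_inverse[OF q R assms(3)] .
  have "(a * b, z' * w) \<in> R"
    using partial_characterD(3)[OF R assms(4) b(1)] .
  then have "z' * w = 1"
    using b(2) partial_characterD(4,5)[OF R] by blast
  then show ?thesis using b(3)
    by (metis mult_right_cancel mult_zero_right zero_neq_one)
qed

text \<open>
  To adjoin a unit \<open>x\<close> to the domain, let \<open>n\<close> be its order modulo the old domain. Its value \<open>w\<close> may be
  any \<open>n\<close>-th root of the value already prescribed at \<open>x ^ n\<close>; this freedom is what produces
  characters that do not vanish on a given nontrivial element.
\<close>
lemma partial_character_extend:
  assumes q: "q > 0" and R: "partial_character q R"
    and n: "n > 0" "(x ^ n, c) \<in> R" and n_least: "\<And>m u. 0 < m \<Longrightarrow> m < n \<Longrightarrow> (x ^ m, u) \<notin> R"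
    and w: "w ^ n = c"
  obtains R' where "partial_character q R'" "R \<subseteq> R'" "(x, w) \<in> R'"
proof -
  define R' where "R' = {(b, z * w ^ k) | a b z k. (a, z) \<in> R \<and> [b = a * x ^ k] (mod q)}"
  have R'I: "(b, u) \<in> R'" if "(a, z) \<in> R" "[b = a * x ^ k] (mod q)" "u = z * w ^ k" for a b z k u
    using that unfolding R'_def by blast
  have cop: "coprime x q"
    using partial_characterD(1)[OF R n(2)] n(1) by simp
  \<comment> \<open>A power of \<open>x\<close> in the domain of \<open>R\<close> has exponent divisible by \<open>n\<close>:
      otherwise its remainder would contradict the minimality of \<open>n\<close>.\<close>
  have dvd: "n dvd k" if k: "(x ^ k, u) \<in> R" for k u
  proof -
    have "(x ^ (n * (k div n)), c ^ (k div n)) \<in> R"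
      using partial_character_power[OF R n(2)] by (simp add: power_mult)
    then obtain b v where b: "(b, v) \<in> R" "[x ^ (n * (k div n)) * b = 1] (mod q)"
      using partial_character_inverse[OF q R] by blast
    have "x ^ k * b = x ^ (k mod n) * (x ^ (n * (k div n)) * b)"
      by (metis mod_mult_div_eq mult.assoc power_add)
    then have "[x ^ k * b = x ^ (k mod n) * 1] (mod q)"
      using b(2) cong_scalar_left by metis
    then have "(x ^ (k mod n), u * v) \<in> R"
      using partial_characterD(3)[OF R k b(1)] partial_characterD(4)[OF R] by simp
    then have "\<not> (0 < k mod n)"
      using n_least[of "k mod n"] n(1) by auto
    then show ?thesis by auto
  qed
  have "u = 1" if u: "(1, u) \<in> R'" for u
  proof -
    obtain a z k where az: "(a, z) \<in> R" "[1 = a * x ^ k] (mod q)" "u = z * w ^ k"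
      using u unfolding R'_def by blast
    obtain b v where b: "(b, v) \<in> R" "[a * b = 1] (mod q)" "z * v = 1"
      using partial_character_inverse[OF q R az(1)] .
    have "[b * 1 = b * (a * x ^ k)] (mod q)"
      using az(2) cong_scalar_left by blast
    moreover have "[a * b * x ^ k = 1 * x ^ k] (mod q)"
      using b(2) cong_scalar_right by blast
    ultimately have "[b = x ^ k] (mod q)"
      by (simp add: mult_ac) (metis cong_trans)
    then have xk: "(x ^ k, v) \<in> R"
      using partial_characterD(4)[OF R b(1)] by blast
    then obtain l where l: "k = n * l" using dvd by blast
    have "(x ^ k, w ^ k) \<in> R"
      using partial_character_power[OF R n(2), of l] w l by (simp add: power_mult)
    then have "w ^ k = v"
      using partial_character_unique[OF q R xk] by simp
    then show ?thesis using b(3) az(3) by simp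
  qed
  moreover have "(1, 1) \<in> R'"
    by (rule R'I[OF partial_characterD(2)[OF R], where k = 0]) auto
  moreover have "coprime b q" if b: "(b, u) \<in> R'" for b u
  proof -
    obtain a z k where "(a, z) \<in> R" "[b = a * x ^ k] (mod q)"
      using b unfolding R'_def by blast
    then show ?thesis
      using partial_characterD(1)[OF R] cop by (metis cong_imp_coprime cong_sym coprime_mult_left_iff coprime_power_left_iff)
  qed
  moreover have "(b * b', u * u') \<in> R'" if bb': "(b, u) \<in> R'" "(b', u') \<in> R'" for b b' u u'
  proof -
    obtain a z k where 1: "(a, z) \<in> R" "[b = a * x ^ k] (mod q)" "u = z * w ^ k"
      using bb'(1) unfolding R'_def by blast
    obtain a' z' k' where 2: "(a', z') \<in> R" "[b' = a' * x ^ k'] (mod q)" "u' = z' * w ^ k'"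
      using bb'(2) unfolding R'_def by blast
    have "[b * b' = (a * x ^ k) * (a' * x ^ k')] (mod q)"
      using 1(2) 2(2) by (rule cong_mult)
    then have "[b * b' = a * a' * x ^ (k + k')] (mod q)"
      by (simp add: power_add mult_ac)
    then show ?thesis
      by (rule R'I[OF partial_characterD(3)[OF R 1(1) 2(1)]]) (simp add: 1 2 power_add mult_ac)
  qed
  moreover have "(b', u) \<in> R'" if bb': "(b, u) \<in> R'" "[b = b'] (mod q)" for b b' u
  proof -
    obtain a z k where "(a, z) \<in> R" "[b = a * x ^ k] (mod q)" "u = z * w ^ k"
      using bb'(1) unfolding R'_def by blast
    then show ?thesis using R'I cong_trans[OF cong_sym[OF bb'(2)]] by blast
  qed
  ultimately have "partial_character q R'"
    unfolding partial_character_def by blast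
  moreover have "R \<subseteq> R'"
    using R'I[where k = 0] by auto
  moreover have "(x, w) \<in> R'"
    by (rule R'I[OF partial_characterD(2)[OF R], where k = 1]) auto
  ultimately show thesis using that by blast
qed

lemma partial_character_extend_exists:
  assumes q: "q > 0" and R: "partial_character q R" and x: "coprime x q"
  obtains R' w where "partial_character q R'" "R \<subseteq> R'" "(x, w) \<in> R'"
proof -
  define Q where "Q = (\<lambda>n. n > 0 \<and> (\<exists>c. (x ^ n, c) \<in> R))"
  have "[1 = x ^ totient q] (mod q)"
    using euler_theorem x cong_sym by blast
  then have "(x ^ totient q, 1) \<in> R"
    using partial_characterD(2,4)[OF R] by blast
  then have ex: "Q (totient q)"
    using q unfolding Q_def by (auto simp: totient_gt_0_iff)
  define n where "n = (LEAST n. Q n)"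
  have Qn: "Q n" unfolding n_def using ex by (rule LeastI)
  then obtain c where n: "n > 0" "(x ^ n, c) \<in> R" unfolding Q_def by blast
  have least: "\<And>m u. 0 < m \<Longrightarrow> m < n \<Longrightarrow> (x ^ m, u) \<notin> R"
    using not_less_Least[of _ Q] unfolding n_def Q_def by blast
  obtain w where "c = w ^ n" using exists_complex_root[of n c] n(1) by blast
  from partial_character_extend[OF q R n least this[symmetric]] that show thesis by blast
qed

lemma partial_character_total:
  assumes q: "q > 0" and R: "partial_character q R"
  obtains R' where "partial_character q R'" "R \<subseteq> R'" "\<And>x. coprime x q \<Longrightarrow> \<exists>z. (x, z) \<in> R'"
proof -
  have ex: "\<exists>R'. partial_character q R' \<and> R \<subseteq> R' \<and> (\<forall>x\<in>X. \<exists>z. (x, z) \<in> R')"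
    if "finite X" "X \<subseteq> {x. coprime x q}" for X
    using that
  proof (induction X rule: finite_induct)
    case (insert x X)
    then obtain R1 where R1: "partial_character q R1" "R \<subseteq> R1" "\<forall>x\<in>X. \<exists>z. (x, z) \<in> R1" by auto
    have "coprime x q" using insert.prems by simp
    then obtain R2 w where "partial_character q R2" "R1 \<subseteq> R2" "(x, w) \<in> R2"
      using partial_character_extend_exists[OF q R1(1)] by blast
    with R1 show ?case by (intro exI[of _ R2]) blast
  qed (use R in auto)
  have "finite {x. x < q \<and> coprime x q}" by simp
  from ex[OF this] obtain R' where R': "partial_character q R'" "R \<subseteq> R'"
    "\<forall>x\<in>{x. x < q \<and> coprime x q}. \<exists>z. (x, z) \<in> R'" by auto
  have "\<exists>z. (x, z) \<in> R'" if "coprime x q" for x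
  proof -
    have "x mod q \<in> {x. x < q \<and> coprime x q}" using q that by simp
    then obtain z where "(x mod q, z) \<in> R'" using R'(3) by blast
    moreover have "[x mod q = x] (mod q)" by simp
    ultimately show ?thesis using partial_characterD(4)[OF R'(1)] by blast
  qed
  with R' that show thesis by blast
qed

lemma dirichlet_character_of_partial:
  assumes q: "q > 0" and R: "partial_character q R" and tot: "\<And>x. coprime x q \<Longrightarrow> \<exists>z. (x, z) \<in> R"
  obtains chi where "dirichlet_character q chi" "\<And>x z. (x, z) \<in> R \<Longrightarrow> chi x = z"
proof -
  define chi where "chi = (\<lambda>x. if coprime x q then (THE z. (x, z) \<in> R) else 0)"
  have val: "chi x = z" if "(x, z) \<in> R" for x z
    unfolding chi_def using that partial_characterD(1)[OF R that] partial_character_unique[OF q R]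
    by (auto intro!: the_equality)
  have in_R: "(x, chi x) \<in> R" if "coprime x q" for x
    using tot[OF that] val by auto
  have "chi (a * b) = chi a * chi b" for a b
  proof (cases "coprime a q \<and> coprime b q")
    case True
    then show ?thesis using val partial_characterD(3)[OF R in_R in_R] by blast
  qed (auto simp: chi_def)
  moreover have "chi (a + q) = chi a" for a
  proof (cases "coprime a q")
    case True
    have "[a = a + q] (mod q)" by (simp add: cong_def)
    then show ?thesis using val partial_characterD(4)[OF R in_R[OF True]] by blast
  next
    case False
    moreover have "coprime (a + q) q \<longleftrightarrow> coprime a q"
      using coprime_add_one_left by (simp add: coprime_iff_gcd_eq_1)
    ultimately show ?thesis by (simp add: chi_def)
  qed
  moreover have "chi a \<noteq> 0 \<longleftrightarrow> coprime a q" for a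
  proof (cases "coprime a q")
    case True
    then have "chi a ^ totient q = 1"
      using partial_character_root_of_unity[OF R in_R] by blast
    then show ?thesis using True q by (auto simp: power_0_left split: if_splits)
  qed (simp add: chi_def)
  ultimately have "dirichlet_character q chi" unfolding dirichlet_character_def by blast
  with val that show thesis by blast
qed

text \<open>
  Extend the trivial character from \<open>{1}\<close> to the group generated by \<open>a\<close>, choosing a primitive root of
  unity of the order of \<open>a\<close> as value at \<open>a\<close>, and then to all units.
\<close>
lemma dirichlet_character_separates:
  assumes q: "q > 0" and a: "coprime a q" "\<not> [a = 1] (mod q)"
  obtains chi where "dirichlet_character q chi" "chi a \<noteq> 1"
proof -
  define R where "R = {(b, 1 :: complex) | b. [b = 1] (mod q)}"
  have R: "partial_character q R"
    unfolding partial_character_def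
  proof (intro conjI allI impI)
    show "coprime b q" if "(b, z) \<in> R" for b z
    proof -
      have "[1 = b] (mod q)" using that by (simp add: R_def cong_sym_eq)
      then show ?thesis using cong_imp_coprime[of 1 b q] by simp
    qed
    show "(b * c, z * w) \<in> R" if "(b, z) \<in> R" "(c, w) \<in> R" for b z c w
      using that cong_mult[of b 1 q c 1] by (simp add: R_def)
    show "(c, z) \<in> R" if "(b, z) \<in> R" "[b = c] (mod q)" for b c z
      using that cong_trans[OF cong_sym[OF that(2)], of 1] by (simp add: R_def)
  qed (simp_all add: R_def)
  define n where "n = (LEAST n. n > 0 \<and> [a ^ n = 1] (mod q))"
  have "totient q > 0 \<and> [a ^ totient q = 1] (mod q)"
    using q euler_theorem[OF a(1)] by (simp add: totient_gt_0_iff)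
  then have n: "n > 0 \<and> [a ^ n = 1] (mod q)"
    unfolding n_def by (rule LeastI)
  have least: "\<And>m u. 0 < m \<Longrightarrow> m < n \<Longrightarrow> (a ^ m, u) \<notin> R"
    using not_less_Least[of _ "\<lambda>n. n > 0 \<and> [a ^ n = 1] (mod q)"] unfolding n_def R_def by blast
  have "n \<noteq> 1" using n a(2) by auto
  then have n2: "n \<ge> 2" using n by linarith
  define w where "w = cis (2 * pi / n)"
  have "w ^ n = cis (real n * (2 * pi / n))" unfolding w_def by (rule Complex.DeMoivre)
  also have "\<dots> = 1" using n by simp
  finally have w: "w ^ n = 1" .
  have "w \<noteq> 1"
  proof (cases "n = 2")
    case False
    then have "0 < 2 * pi / n" "2 * pi / n < pi" using n2 by (auto simp: field_simps)
    then have "Im w > 0" unfolding w_def by (simp add: sin_gt_zero)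
    then show ?thesis by auto
  qed (simp add: w_def cis_pi)
  have "(a ^ n, 1) \<in> R" using n by (auto simp: R_def)
  then obtain R1 where R1: "partial_character q R1" "(a, w) \<in> R1"
    using partial_character_extend[OF q R _ _ least w] n by metis
  obtain R2 where R2: "partial_character q R2" "R1 \<subseteq> R2" "\<And>x. coprime x q \<Longrightarrow> \<exists>z. (x, z) \<in> R2"
    using partial_character_total[OF q R1(1)] by blast
  obtain chi where "dirichlet_character q chi" "\<And>x z. (x, z) \<in> R2 \<Longrightarrow> chi x = z"
    using dirichlet_character_of_partial[OF q R2(1,3)] by blast
  with R1 R2 \<open>w \<noteq> 1\<close> that show thesis by blast
qed

section \<open>Dirichlet characters\<close>

lemma dirichlet_characterD:
  assumes "dirichlet_character q chi"
  shows "chi (a * b) = chi a * chi b" and "chi (a + q) = chi a" and "chi a \<noteq> 0 \<longleftrightarrow> coprime a q"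
  using assms unfolding dirichlet_character_def by blast+

lemma dirichlet_character_cong:
  assumes chi: "dirichlet_character q chi" and "[a = b] (mod q)"
  shows "chi a = chi b"
proof -
  have shift: "chi (a + k * q) = chi a" for a k
  proof (induction k)
    case (Suc k)
    then show ?case
      using dirichlet_characterD(2)[OF chi, of "a + k * q"] by (simp add: algebra_simps)
  qed simp
  have "chi a = chi (a mod q)" for a
    using shift[of "a mod q" "a div q"] by simp
  then show ?thesis using assms(2) unfolding cong_def by metis
qed

lemma dirichlet_character_one:
  assumes "dirichlet_character q chi"
  shows "chi 1 = 1"
  using dirichlet_characterD(1)[OF assms, of 1 1] dirichlet_characterD(3)[OF assms, of 1] by simp

lemma dirichlet_character_power_arg:
  assumes "dirichlet_character q chi"
  shows "chi (a ^ n) = chi a ^ n"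
  by (induction n)
    (use dirichlet_character_one[OF assms] dirichlet_characterD(1)[OF assms] in auto)

lemma dirichlet_character_root_of_unity:
  assumes chi: "dirichlet_character q chi" and "coprime a q"
  shows "chi a ^ totient q = 1"
  using dirichlet_character_cong[OF chi euler_theorem[OF assms(2)]]
  by (simp only: dirichlet_character_power_arg[OF chi] dirichlet_character_one[OF chi])

lemma dirichlet_character_norm:
  assumes q: "q > 0" and chi: "dirichlet_character q chi" and "coprime a q"
  shows "norm (chi a) = 1"
proof -
  have "norm (chi a) ^ totient q = 1"
    by (metis dirichlet_character_root_of_unity[OF chi assms(3)] norm_one norm_power)
  then show ?thesis
    using q power_eq_1_iff[of "norm (chi a)" "totient q"] by auto
qed

lemma dirichlet_character_power:
  assumes chi: "dirichlet_character q chi" and "k > 0"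
  shows "dirichlet_character q (\<lambda>a. chi a ^ k)"
  using assms unfolding dirichlet_character_def by (auto simp: power_mult_distrib)

text \<open>
  Finiteness is needed because a sum over an infinite set of characters would be zero by convention.
\<close>
lemma finite_dirichlet_characters:
  assumes q: "q > 0"
  shows "finite {chi. dirichlet_character q chi}"
proof -
  let ?V = "insert 0 {z :: complex. z ^ totient q = 1}"
  let ?r = "\<lambda>chi :: nat \<Rightarrow> complex. restrict chi {..<q}"
  have "finite (\<Pi>\<^sub>E a\<in>{..<q}. ?V)"
    using q finite_nth_roots[of "totient q" 1] by (intro finite_PiE) auto
  moreover have "?r ` {chi. dirichlet_character q chi} \<subseteq> (\<Pi>\<^sub>E a\<in>{..<q}. ?V)"
  proof (rule image_subsetI, unfold restrict_PiE_iff, rule ballI)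
    fix chi a assume "chi \<in> {chi. dirichlet_character q chi}"
    then have chi: "dirichlet_character q chi" by simp
    show "chi a \<in> ?V"
      using dirichlet_character_root_of_unity[OF chi, of a] dirichlet_characterD(3)[OF chi, of a] by blast
  qed
  ultimately have "finite (?r ` {chi. dirichlet_character q chi})"
    by (rule finite_subset[rotated])
  moreover have "inj_on ?r {chi. dirichlet_character q chi}"
  proof (rule inj_onI, clarsimp)
    fix chi psi
    assume chi: "dirichlet_character q chi" and psi: "dirichlet_character q psi"
      and eq: "?r chi = ?r psi"
    have "chi a = psi a" for a
    proof -
      have "[a = a mod q] (mod q)" by simp
      then have "chi a = chi (a mod q)" "psi a = psi (a mod q)"
        using dirichlet_character_cong chi psi by blast+
      moreover have "chi (a mod q) = psi (a mod q)"
        using fun_cong[OF eq, of "a mod q"] q by simp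
      ultimately show ?thesis by simp
    qed
    then show "chi = psi" by blast
  qed
  ultimately show ?thesis by (rule finite_imageD)
qed

lemma dirichlet_character_minus_one:
  assumes q: "q > 0" and a: "coprime a q" "\<not> [a = 1] (mod q)" "[a ^ 2 = 1] (mod q)"
  obtains chi where "dirichlet_character q chi" "chi a = -1"
proof -
  obtain chi where chi: "dirichlet_character q chi" "chi a \<noteq> 1"
    using dirichlet_character_separates[OF q a(1,2)] .
  have "chi a ^ 2 = chi (a ^ 2)"
    by (simp only: dirichlet_character_power_arg[OF chi(1)])
  also have "\<dots> = 1"
    using dirichlet_character_cong[OF chi(1) a(3)] dirichlet_character_one[OF chi(1)] by simp
  finally have "chi a ^ 2 = 1" .
  then have "chi a = 1 \<or> chi a = -1" by (simp add: power2_eq_1_iff)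
  with chi that show thesis by blast
qed

lemma power_two_power_eq_1_odd:
  fixes z :: "'a :: idom"
  assumes "odd m" "z ^ m = 1" "z ^ (2 ^ t) = 1"
  shows "z = 1"
  using assms(2,3)
proof (induction t arbitrary: z)
  case (Suc t)
  have "(z ^ 2) ^ m = (z ^ m) ^ 2" by (simp only: power_mult[symmetric] mult.commute)
  then have 1: "(z ^ 2) ^ m = 1" using Suc.prems(1) by simp
  have "(z ^ 2) ^ (2 ^ t) = z ^ (2 ^ Suc t)" by (simp only: power_mult[symmetric] power_Suc)
  then have "(z ^ 2) ^ (2 ^ t) = 1" using Suc.prems(2) by simp
  with 1 have "z ^ 2 = 1" by (rule Suc.IH)
  then have "z = 1 \<or> z = -1" by (simp add: power2_eq_1_iff)
  with Suc.prems(1) assms(1) show ?case by auto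
qed simp

lemma two_power_decompose:
  assumes "n > (0 :: nat)"
  obtains e m where "n = 2 ^ e * m" "odd m"
proof -
  have "\<not> is_unit (2 :: nat)" by simp
  from multiplicity_decompose'[of n, OF _ this] assms obtain m where
    "n = 2 ^ multiplicity 2 n * m" "\<not> 2 dvd m" by auto
  then show thesis using that by blast
qed

section \<open>Residues and characters for the race\<close>

text \<open>
  If all units were of order at most two, then by the Chinese remainder theorem the unit that is
  congruent to 2 modulo the odd part of \<open>q\<close> and to 3 modulo its 2-part would force the odd part to
  divide \<open>2\<^sup>2 - 1\<close> and the 2-part to divide \<open>3\<^sup>2 - 1\<close>, that is, \<open>q\<close> to divide 24.
\<close>
lemma ex_unit_square_neq_1:
  fixes q :: nat
  assumes q: "q \<ge> 7" "q \<notin> {8, 12, 24}"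
  obtains g where "coprime g q" "\<not> [g ^ 2 = 1] (mod q)"
proof -
  obtain e m where em: "q = 2 ^ e * m" "odd m"
    using two_power_decompose[of q] q by auto
  have cop: "coprime (2 ^ e) m" using em(2) by simp
  obtain x where x: "[x = 3] (mod 2 ^ e)" "[x = 2] (mod m)"
    using binary_chinese_remainder_nat[OF cop, of 3 2] by blast
  have "coprime x (2 ^ e)"
    using cong_imp_coprime[OF cong_sym[OF x(1)]] by simp
  moreover have "coprime x m"
    using cong_imp_coprime[OF cong_sym[OF x(2)]] em(2) by simp
  ultimately have "coprime x q" using em by simp
  moreover have "\<not> [x ^ 2 = 1] (mod q)"
  proof
    assume "[x ^ 2 = 1] (mod q)"
    then have "[x ^ 2 = 1] (mod 2 ^ e)" "[x ^ 2 = 1] (mod m)"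
      unfolding em(1) by (meson cong_modulus_mult_nat cong_dvd_modulus_nat dvd_triv_left dvd_triv_right)+
    moreover have "[x ^ 2 = 3 ^ 2] (mod 2 ^ e)" "[x ^ 2 = 2 ^ 2] (mod m)"
      using cong_pow[OF x(1)] cong_pow[OF x(2)] by blast+
    ultimately have "[3 ^ 2 = 1] (mod (2 ^ e :: nat))" "[2 ^ 2 = 1] (mod m)"
      by (metis cong_sym cong_trans)+
    then have "[9 = 1] (mod (2 ^ e :: nat))" "[4 = 1] (mod m)" by simp_all
    then have "2 ^ e dvd (9 - 1 :: nat)" "m dvd 4 - 1"
      using cong_altdef_nat[of 1 9 "2 ^ e"] cong_altdef_nat[of 1 4 m] by simp_all
    then have "2 ^ e dvd (8 :: nat)" "m dvd 3" by simp_all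
    then have dvd: "q dvd 8 * 3" unfolding em(1) by (rule mult_dvd_mono)
    then obtain k where "8 * 3 = q * k" by (rule dvdE)
    then have k: "q * k = 24" by simp
    have "k < 4"
    proof (rule ccontr)
      assume "\<not> k < 4"
      then have "7 * 4 \<le> q * k" using q(1) by (intro mult_le_mono) auto
      then show False using k by simp
    qed
    then have "k = 0 \<or> k = 1 \<or> k = 2 \<or> k = 3" by linarith
    then have "q = 24 \<or> q = 12 \<or> q = 8" using k by (elim disjE) simp_all
    then show False using q(2) by simp
  qed
  ultimately show thesis using that by blast
qed

lemma totient_gt_4:
  assumes q: "q \<ge> 7" "q \<notin> {8, 10, 12}"
  shows "totient q > 4"
proof -
  obtain e m where em: "q = 2 ^ e * m" "odd m"
    using two_power_decompose[of q] q by auto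
  have tot: "totient q = totient (2 ^ e) * totient m"
    unfolding em(1) using em(2) by (intro totient_mult_coprime) simp
  have m0: "m > 0" using em(2) by (rule odd_pos)
  have pos: "totient m \<ge> 1" "totient (2 ^ e) \<ge> 1" using m0 by (simp_all add: Suc_le_eq)
  consider "m \<ge> 7" | "m = 1" | "m = 3" | "m = 5"
  proof -
    have "m \<ge> 7 \<or> m = 0 \<or> m = 1 \<or> m = 2 \<or> m = 3 \<or> m = 4 \<or> m = 5 \<or> m = 6" by linarith
    moreover have "m \<noteq> 0" "m \<noteq> 2" "m \<noteq> 4" "m \<noteq> 6" using em(2) m0 by auto
    ultimately show thesis using that by blast
  qed
  then show ?thesis
  proof cases
    case 1
    have "{1, 2, 4, m - 1, m - 2} \<subseteq> totatives m"
    proof -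
      have "coprime (m - 1) m" using 1 by (intro coprime_diff_one_left_nat) simp
      moreover have "coprime (m - 2) m"
      proof -
        have "d dvd 1" if "d dvd m - 2" "d dvd m" for d
        proof -
          have "m - (m - 2) = 2" using 1 by simp
          then have "d dvd 2" using dvd_diff_nat[OF that(2,1)] by metis
          then show ?thesis using that(2) em(2) coprime_common_divisor[of 2 m d] by simp
        qed
        then show ?thesis by (intro coprimeI) auto
      qed
      moreover have "coprime 2 m" using em(2) by simp
      moreover have "coprime 4 m" using em(2) coprime_power_left_iff[of 2 2 m] by simp
      ultimately show ?thesis using 1 by (auto simp: totatives_def)
    qed
    moreover have "card {1, 2, 4, m - 1, m - 2} = 5"
    proof -
      have "distinct [1, 2, 4, m - 1, m - 2]" using 1 by auto
      from distinct_card[OF this] show ?thesis by simp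
    qed
    ultimately have "totient m \<ge> 5"
      unfolding totient_def using card_mono[of "totatives m"] by (metis finite_totatives)
    then have "1 * 5 \<le> totient (2 ^ e) * totient m" using pos(2) by (intro mult_le_mono) auto
    then show ?thesis using tot by simp
  next
    case 2
    have "e \<noteq> 0" "e \<noteq> 1" "e \<noteq> 2" "e \<noteq> 3"
      using 2 q em(1) by (intro notI; simp)+
    then have "e \<ge> 4" by linarith
    then have "2 ^ 4 dvd q" unfolding em(1) by (intro dvd_mult2 le_imp_power_dvd)
    then have "totient (2 ^ 4) \<le> totient q" using q by (intro totient_dvd_mono) auto
    then show ?thesis by (simp only: totient_power) simp
  next
    case 3
    have "e \<noteq> 0" "e \<noteq> 1" "e \<noteq> 2"
      using 3 q em(1) by (intro notI; simp)+
    then have "e \<ge> 3" by linarith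
    then have "2 ^ 3 * 3 dvd q" unfolding em(1) using 3 by (intro mult_dvd_mono le_imp_power_dvd) auto
    then have "totient (2 ^ 3 * 3) \<le> totient q" using q by (intro totient_dvd_mono) auto
    moreover have "totient (2 ^ 3 * 3) = totient (2 ^ 3) * totient 3"
      by (intro totient_mult_coprime) (simp only: coprime_power_left_iff, simp)
    ultimately show ?thesis by simp
  next
    case 4
    have "e \<noteq> 0" "e \<noteq> 1"
      using 4 q em(1) by (intro notI; simp)+
    then have "e \<ge> 2" by linarith
    then have "2 ^ 2 * 5 dvd q" unfolding em(1) using 4 by (intro mult_dvd_mono le_imp_power_dvd) auto
    then have "totient (2 ^ 2 * 5) \<le> totient q" using q by (intro totient_dvd_mono) auto
    moreover have "totient (2 ^ 2 * 5) = totient (2 ^ 2) * totient 5"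
      by (intro totient_mult_coprime) (simp only: coprime_power_left_iff, simp)
    moreover have "totient 5 = (4 :: nat)" by (simp add: totient_prime)
    ultimately show ?thesis by simp
  qed
qed

text \<open>
  If some unit has an order that is not a power of two, then odd order and 2-power order can be kept
  apart: \<open>b\<close> has odd order, \<open>a = -1\<close> has order two, \<open>chi\<close> is a 2-power of a character (hence trivial
  at \<open>-1\<close>) and \<open>psi\<close> an odd power of a character whose exponent annihilates \<open>b\<close>. If the argument of
  \<open>chi b\<close> is larger than 120 degrees in absolute value, then squaring \<open>chi\<close> makes it smaller.
\<close>
lemma race_configuration_odd:
  assumes q: "q > 2" and g: "coprime g q" "\<not> [g ^ (2 ^ totient q) = 1] (mod q)"
  obtains chi psi a b where "dirichlet_character q chi" "dirichlet_character q psi"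
    "coprime a q" "coprime b q" "chi a = 1" "psi a = -1"
    "psi b = 1" "chi b \<noteq> 1" "Re (chi b) \<ge> - 1 / 2"
proof -
  define t where "t = totient q"
  have q0: "q > 0" and t: "t > 0" using q by (simp_all add: t_def)
  obtain e m where em: "t = 2 ^ e * m" "odd m"
    using two_power_decompose[OF t] .
  define b where "b = g ^ (2 ^ t)"
  have b: "coprime b q" "\<not> [b = 1] (mod q)"
    using g by (simp_all add: b_def t_def)
  have "e \<le> t"
  proof -
    have "e < 2 ^ e" by simp
    also have "\<dots> \<le> t" using em t by (metis dvd_imp_le dvd_triv_left)
    finally show ?thesis by simp
  qed
  have "2 ^ t * m = 2 ^ e * 2 ^ (t - e) * m"
    using \<open>e \<le> t\<close> by (simp flip: power_add)
  also have "\<dots> = 2 ^ e * m * 2 ^ (t - e)" by (simp only: mult_ac)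
  also have "\<dots> = t * 2 ^ (t - e)" by (simp only: em(1)[symmetric])
  finally have "2 ^ t * m = t * 2 ^ (t - e)" .
  then have "b ^ m = (g ^ t) ^ (2 ^ (t - e))"
    by (simp only: b_def power_mult[symmetric])
  moreover have "[(g ^ t) ^ (2 ^ (t - e)) = 1 ^ (2 ^ (t - e))] (mod q)"
    unfolding t_def by (rule cong_pow[OF euler_theorem[OF g(1)]])
  ultimately have bm: "[b ^ m = 1] (mod q)" by simp
  obtain chi0 where chi0: "dirichlet_character q chi0" "chi0 b \<noteq> 1"
    using dirichlet_character_separates[OF q0 b] .
  define chi1 where "chi1 = (\<lambda>a. chi0 a ^ (2 ^ t))"
  have chi1: "dirichlet_character q chi1"
    unfolding chi1_def by (rule dirichlet_character_power[OF chi0(1)]) simp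
  have root: "chi b ^ m = 1" if "dirichlet_character q chi" for chi
  proof -
    have "chi (b ^ m) = 1"
      using dirichlet_character_cong[OF that bm] dirichlet_character_one[OF that] by simp
    then show ?thesis by (simp only: dirichlet_character_power_arg[OF that])
  qed
  have chi1b: "chi1 b \<noteq> 1"
    using power_two_power_eq_1_odd[OF em(2) root[OF chi0(1)]] chi0(2) unfolding chi1_def by blast
  define a where "a = q - 1"
  have sq: "a * a = 1 + q * (q - 2)"
  proof -
    obtain n where "q = 2 + n" using q le_Suc_ex[of 2 q] by auto
    then show ?thesis by (simp add: a_def)
  qed
  have a: "coprime a q" "\<not> [a = 1] (mod q)" "[a ^ 2 = 1] (mod q)"
  proof -
    show "coprime a q" unfolding a_def using q0 by (rule coprime_diff_one_left_nat)
    show "\<not> [a = 1] (mod q)" using q by (simp add: a_def cong_def)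
    show "[a ^ 2 = 1] (mod q)"
      unfolding power2_eq_square sq cong_def by (rule mod_mult_self2)
  qed
  have chi1a: "chi1 a = 1"
  proof -
    have "chi0 a ^ 2 = chi0 (a ^ 2)" by (simp only: dirichlet_character_power_arg[OF chi0(1)])
    also have "\<dots> = 1"
      using dirichlet_character_cong[OF chi0(1) a(3)] dirichlet_character_one[OF chi0(1)] by simp
    finally have "(chi0 a ^ 2) ^ (2 ^ (t - 1)) = 1" by simp
    moreover have "2 * 2 ^ (t - 1) = (2 :: nat) ^ t" using t by (cases t) auto
    ultimately show ?thesis unfolding chi1_def by (simp only: power_mult[symmetric])
  qed
  obtain psi0 where psi0: "dirichlet_character q psi0" "psi0 a = -1"
    using dirichlet_character_minus_one[OF q0 a] .
  define psi where "psi = (\<lambda>a. psi0 a ^ m)"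
  have psi: "dirichlet_character q psi"
    unfolding psi_def by (rule dirichlet_character_power[OF psi0(1)]) (use em(2) in \<open>auto elim: oddE\<close>)
  have psia: "psi a = -1" and psib: "psi b = 1"
    using psi0(2) em(2) root[OF psi0(1)] by (simp_all add: psi_def)
  show thesis
  proof (cases "Re (chi1 b) \<ge> - 1 / 2")
    case True
    from that[OF chi1 psi a(1) b(1) chi1a psia psib chi1b this] show ?thesis .
  next
    case False
    define chi2 where "chi2 = (\<lambda>a. chi1 a ^ 2)"
    have chi2: "dirichlet_character q chi2"
      unfolding chi2_def by (rule dirichlet_character_power[OF chi1]) simp
    have "(chi1 b) ^ (2 ^ 1) \<noteq> 1"
      using power_two_power_eq_1_odd[OF em(2) root[OF chi1], of 1] chi1b by blast
    then have chi2b: "chi2 b \<noteq> 1" by (simp add: chi2_def)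
    have n1: "(Re (chi1 b))\<^sup>2 + (Im (chi1 b))\<^sup>2 = 1"
      using dirichlet_character_norm[OF q0 chi1 b(1)] by (simp add: cmod_def)
    have "(1 / 2)\<^sup>2 \<le> (- Re (chi1 b))\<^sup>2"
      using False by (intro power_mono) auto
    then have "Re (chi2 b) \<ge> - 1 / 2"
      using n1 unfolding chi2_def by (simp add: power2_eq_square)
    moreover have "chi2 a = 1" by (simp add: chi2_def chi1a)
    ultimately show ?thesis using that[OF chi2 psi a(1) b(1) _ psia psib chi2b] by blast
  qed
qed

text \<open>
  If all units have 2-power order, some 2-power \<open>chi\<close> of a character takes only fourth roots of unity as
  values, among them one with square \<open>-1\<close>. More than four units cannot have distinct values
  under \<open>chi\<close>, so that its kernel contains a nontrivial element, and therefore an element \<open>a\<close> of order two.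
\<close>
lemma race_configuration_2_group:
  assumes q: "totient q > 4"
    and two: "\<And>g. coprime g q \<Longrightarrow> [g ^ (2 ^ totient q) = 1] (mod q)"
    and g: "coprime g q" "\<not> [g ^ 2 = 1] (mod q)"
  obtains chi psi a b where "dirichlet_character q chi" "dirichlet_character q psi"
    "coprime a q" "coprime b q" "chi a = 1" "psi a = -1" "chi b ^ 2 = -1"
proof -
  define t where "t = totient q"
  have q0: "q > 0" using q by (cases q) auto
  have "coprime (g ^ 2) q" using g by simp
  then obtain chi0 where chi0: "dirichlet_character q chi0" "chi0 (g ^ 2) \<noteq> 1"
    using dirichlet_character_separates[OF q0 _ g(2)] by blast
  define Q where "Q = (\<lambda>j. \<forall>a. coprime a q \<longrightarrow> (chi0 a ^ (2 ^ j)) ^ 2 = 1)"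
  have "Q t"
  proof -
    have "chi0 a ^ (2 ^ t) = 1" if "coprime a q" for a
    proof -
      have "chi0 a ^ (2 ^ t) = chi0 (a ^ (2 ^ t))"
        by (simp only: dirichlet_character_power_arg[OF chi0(1)])
      also have "\<dots> = 1"
        using dirichlet_character_cong[OF chi0(1) two[OF that]] dirichlet_character_one[OF chi0(1)]
        by (simp add: t_def)
      finally show ?thesis .
    qed
    then show ?thesis by (simp add: Q_def)
  qed
  moreover have "\<not> Q 0"
    using chi0(2) g(1) dirichlet_character_power_arg[OF chi0(1), of g 2] unfolding Q_def by auto
  ultimately have "\<exists>k<t. (\<forall>i\<le>k. \<not> Q i) \<and> Q (Suc k)" by (rule ex_least_nat_less)
  then obtain j where j: "\<not> Q j" "Q (Suc j)" by blast
  define chi where "chi = (\<lambda>a. chi0 a ^ (2 ^ j))"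
  have chi: "dirichlet_character q chi"
    unfolding chi_def by (rule dirichlet_character_power[OF chi0(1)]) simp
  have "chi0 a ^ (2 ^ Suc j) = chi a ^ 2" for a
    unfolding chi_def power_mult[symmetric] by (simp add: mult.commute)
  then have chi4: "(chi a ^ 2) ^ 2 = 1" if "coprime a q" for a
    using j(2) that unfolding Q_def by simp
  obtain b where b: "coprime b q" "chi b ^ 2 \<noteq> 1"
    using j(1) unfolding Q_def chi_def by auto
  have chib: "chi b ^ 2 = -1"
    using chi4[OF b(1)] b(2) power2_eq_1_iff[of "chi b ^ 2"] by blast
  have "\<not> inj_on chi (totatives q)"
  proof
    assume "inj_on chi (totatives q)"
    moreover have "chi ` totatives q \<subseteq> {z. z ^ 4 = 1}"
    proof safe
      fix x assume "x \<in> totatives q"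
      then have "(chi x ^ 2) ^ 2 = 1" by (intro chi4) (simp add: totatives_def)
      then show "chi x ^ 4 = 1" by (simp flip: power_mult)
    qed
    moreover have "finite {z :: complex. z ^ 4 = 1}" by (rule finite_nth_roots) simp
    ultimately have "card (totatives q) \<le> card {z :: complex. z ^ 4 = 1}"
      by (rule card_inj_on_le)
    then show False using q card_nth_roots[of 1 4] by (simp add: totient_def)
  qed
  then obtain x y where xy: "x \<in> totatives q" "y \<in> totatives q" "chi x = chi y" "x \<noteq> y"
    unfolding inj_on_def by blast
  then have cxy: "coprime x q" "coprime y q" by (auto simp: totatives_def)
  have lt: "x < q" "y < q"
    using xy(1,2)[THEN totatives_less] q totient_le[of q] by simp_all
  define c where "c = x * y ^ (t - 1)"
  have tpow: "z * z ^ (t - 1) = z ^ t" for z :: "'a :: monoid_mult"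
    using q0 by (metis power_eq_if totient_0_iff neq0_conv t_def)
  have cc: "coprime c q" using cxy by (simp add: c_def)
  have chic: "chi c = 1"
  proof -
    have "chi c = chi y * chi y ^ (t - 1)"
      unfolding c_def dirichlet_characterD(1)[OF chi] dirichlet_character_power_arg[OF chi] xy(3) ..
    then show ?thesis
      using tpow[of "chi y"] dirichlet_character_root_of_unity[OF chi cxy(2)] by (simp add: t_def)
  qed
  have c1: "\<not> [c = 1] (mod q)"
  proof
    assume "[c = 1] (mod q)"
    then have "[c * y = 1 * y] (mod q)" by (rule cong_scalar_right)
    moreover have "c * y = x * y ^ t" using tpow[of y] by (simp add: c_def mult_ac)
    moreover have "[x * y ^ t = x * 1] (mod q)"
      unfolding t_def by (rule cong_scalar_left[OF euler_theorem[OF cxy(2)]])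
    ultimately have "[x * 1 = 1 * y] (mod q)" using cong_trans[OF cong_sym] by metis
    then have "[x = y] (mod q)" by simp
    then show False using lt xy(4) by (simp add: cong_def)
  qed
  have "[c ^ (2 ^ t) = 1] (mod q)" "\<not> [c ^ (2 ^ 0) = 1] (mod q)"
    using two[OF cc] c1 by (simp_all add: t_def)
  from ex_least_nat_less[of "\<lambda>k. [c ^ (2 ^ k) = 1] (mod q)", OF this]
  obtain k where k: "\<not> [c ^ (2 ^ k) = 1] (mod q)" "[c ^ (2 ^ Suc k) = 1] (mod q)" by blast
  define a where "a = c ^ (2 ^ k)"
  have a: "coprime a q" "\<not> [a = 1] (mod q)" "[a ^ 2 = 1] (mod q)"
    using cc k unfolding a_def power_mult[symmetric] by (simp_all add: mult.commute)
  obtain psi where psi: "dirichlet_character q psi" "psi a = -1"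
    using dirichlet_character_minus_one[OF q0 a] .
  have "chi a = 1"
    unfolding a_def dirichlet_character_power_arg[OF chi] chic by simp
  from that[OF chi psi(1) a(1) b(1) this psi(2) chib] show thesis .
qed

text \<open>
  The residues and characters of both cases, with the third residue being the inverse of the second
  one: complex conjugation then interchanges their roles.
\<close>
lemma race_configuration:
  assumes q: "q \<ge> 7" "q \<notin> {8, 10, 12, 24}"
  obtains chi psi a1 a2 a3 where "dirichlet_character q chi" "dirichlet_character q psi"
    "{a1, a2, a3} \<subseteq> totatives q" "chi a1 = 1" "psi a1 = -1"
    "chi a3 = cnj (chi a2)" "psi a3 = cnj (psi a2)"
    "(psi a2 = 1 \<and> chi a2 \<noteq> 1 \<and> - 1 / 2 \<le> Re (chi a2)) \<or> (chi a2)\<^sup>2 = -1"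
proof -
  have "\<exists>chi psi a b. dirichlet_character q chi \<and> dirichlet_character q psi \<and>
    coprime a q \<and> coprime b q \<and> chi a = 1 \<and> psi a = -1 \<and>
    ((psi b = 1 \<and> chi b \<noteq> 1 \<and> - 1 / 2 \<le> Re (chi b)) \<or> (chi b)\<^sup>2 = -1)"
  proof (cases "\<exists>g. coprime g q \<and> \<not> [g ^ (2 ^ totient q) = 1] (mod q)")
    case True
    then obtain g where g: "coprime g q" "\<not> [g ^ (2 ^ totient q) = 1] (mod q)" by blast
    have "q > 2" using q by simp
    from race_configuration_odd[OF this g] show ?thesis by metis
  next
    case False
    obtain g where g: "coprime g q" "\<not> [g ^ 2 = 1] (mod q)"
      using ex_unit_square_neq_1[of q] q by auto
    have tot: "totient q > 4" using q by (intro totient_gt_4) auto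
    from race_configuration_2_group[OF tot _ g] False show ?thesis by metis
  qed
  then obtain chi psi a b where chi: "dirichlet_character q chi" and psi: "dirichlet_character q psi"
    and cop: "coprime a q" "coprime b q" and val: "chi a = 1" "psi a = -1"
      "(psi b = 1 \<and> chi b \<noteq> 1 \<and> - 1 / 2 \<le> Re (chi b)) \<or> (chi b)\<^sup>2 = -1"
    by blast
  have q1: "q > 1" and t: "totient q > 0" using q by simp_all
  have red: "eta (x mod q) = eta x" if "dirichlet_character q eta" for eta x
    by (rule dirichlet_character_cong[OF that]) simp
  have mem: "x mod q \<in> totatives q" if "coprime x q" for x
  proof -
    have "coprime (x mod q) q" using that q1 by simp
    moreover from this have "x mod q \<noteq> 0" using q1 by (intro notI) simp
    ultimately show ?thesis using q1 by (simp add: totatives_def less_imp_le)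
  qed
  have inv: "eta (b ^ (totient q - 1)) = cnj (eta b)" if eta: "dirichlet_character q eta" for eta
  proof -
    have "eta b * eta b ^ (totient q - 1) = 1"
      using dirichlet_character_root_of_unity[OF eta cop(2)] t by (metis power_eq_if neq0_conv)
    moreover have "eta b * cnj (eta b) = 1"
      using dirichlet_character_norm[OF _ eta cop(2)] q1 complex_norm_square[of "eta b"] by simp
    ultimately have "eta b ^ (totient q - 1) = cnj (eta b)"
      by (metis mult_cancel_left mult_zero_left zero_neq_one)
    then show ?thesis by (simp only: dirichlet_character_power_arg[OF eta])
  qed
  show thesis
  proof (rule that[OF chi psi])
    show "{a mod q, b mod q, b ^ (totient q - 1) mod q} \<subseteq> totatives q"
      using mem cop by simp
  qed (use val in \<open>simp_all only: red[OF chi] red[OF psi] inv[OF chi] inv[OF psi]\<close>)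
qed

section \<open>Sine polynomials on the unit circle\<close>

text \<open>
  The truncated logarithm that remains of a sum of \<open>x\<close> to the power \<open>\<rho>\<close> over \<open>\<rho>\<close> for zeros \<open>\<rho>\<close> at the heights
  \<open>k * \<gamma>\<close> when \<open>\<gamma>\<close> is large.
\<close>
definition harmonic_poly :: "nat list \<Rightarrow> complex \<Rightarrow> complex" where
  "harmonic_poly ks w = (\<Sum>k\<leftarrow>ks. w ^ k / of_nat k)"

text \<open>
  Multiplicities chosen such that \<open>\<Sum>k. sin (k * \<theta>) / k\<close> over this list is negative for all angles \<open>\<theta>\<close>
  between 30 and 150 degrees, although no harmonic has a negative coefficient; at 30 degrees the sines of the
  frequencies 1 to 6 are nonnegative, which is why the list reaches beyond them.
\<close>
definition odd_harmonics :: "nat list" where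
  "odd_harmonics = [3, 5, 5, 5, 7, 7, 7, 7, 9, 9, 9, 11]"

text \<open>
  The coefficients of this polynomial in the Bernstein bases of the two halves of the interval are all
  positive.
\<close>
lemma quintic_pos:
  fixes y :: real
  assumes "1 / 4 \<le> y" "y \<le> 1"
  shows "0 < - 12 + 316 / 3 * y - 1648 / 5 * y ^ 2 + 3392 / 7 * y ^ 3 - 1024 / 3 * y ^ 4 + 1024 / 11 * y ^ 5"
    (is "0 < ?Q y")
proof (cases "y \<le> 5 / 8")
  case True
  define u v where "u = 8 / 3 * y - 2 / 3" and "v = 5 / 3 - 8 / 3 * y"
  have uv: "0 \<le> u" "0 \<le> v" "u + v = 1" using assms True by (simp_all add: u_def v_def)
  have "?Q y = 24 / 385 * v ^ 5 + 3669 / 770 * u * v ^ 4 + 2787 / 385 * u ^ 2 * v ^ 3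
      + 13467 / 3080 * u ^ 3 * v ^ 2 + 1635 / 1232 * u ^ 4 * v + 447 / 2464 * u ^ 5"
    unfolding u_def v_def by (simp add: power_numeral_reduce field_simps)
  also have "\<dots> > 0"
  proof (cases "u = 0")
    case True
    then show ?thesis using uv by simp
  next
    case False
    then have "u > 0" using uv by simp
    then show ?thesis using uv
      by (intro add_nonneg_pos add_nonneg_nonneg mult_nonneg_nonneg) auto
  qed
  finally show ?thesis .
next
  case False
  define u v where "u = 8 / 3 * y - 5 / 3" and "v = 8 / 3 - 8 / 3 * y"
  have uv: "0 \<le> u" "0 \<le> v" "u + v = 1" using assms False by (simp_all add: u_def v_def)
  have "?Q y = 447 / 2464 * v ^ 5 + 75 / 154 * u * v ^ 4 + 3117 / 3080 * u ^ 2 * v ^ 3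
      + 2553 / 1540 * u ^ 3 * v ^ 2 + 249 / 770 * u ^ 4 * v + 24 / 385 * u ^ 5"
    unfolding u_def v_def by (simp add: power_numeral_reduce field_simps)
  also have "\<dots> > 0"
  proof (cases "u = 0")
    case True
    then show ?thesis using uv by simp
  next
    case False
    then have "u > 0" using uv by simp
    then show ?thesis using uv
      by (intro add_nonneg_pos add_nonneg_nonneg mult_nonneg_nonneg) auto
  qed
  finally show ?thesis .
qed

text \<open>
  The Chebyshev recurrence of \<open>sin (k * \<theta>)\<close> for steps of two.
\<close>
lemma Im_odd_power_rec:
  fixes w :: complex
  assumes "norm w = 1" and "j = k + 2" and "l = k + 4"
  shows "Im (w ^ l) = (2 - 4 * (Im w)\<^sup>2) * Im (w ^ j) - Im (w ^ k)"
proof -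
  have n: "(Re w)\<^sup>2 + (Im w)\<^sup>2 = 1" using assms by (simp add: cmod_def)
  have "w ^ 4 + 1 = of_real (2 - 4 * (Im w)\<^sup>2) * w ^ 2"
  proof -
    have "w * cnj w = 1" using assms complex_norm_square[of w] by simp
    then have "(w * cnj w) ^ 2 = 1" by simp
    then have "w ^ 4 + 1 = w ^ 2 * (w ^ 2 + cnj (w ^ 2))"
      by (simp add: power_mult_distrib algebra_simps flip: power_add)
    also have "w ^ 2 + cnj (w ^ 2) = of_real (2 * Re (w ^ 2))" by (rule complex_add_cnj)
    also have "2 * Re (w ^ 2) = 2 - 4 * (Im w)\<^sup>2" using n by (simp add: power2_eq_square)
    finally show ?thesis by (simp add: mult.commute)
  qed
  then have "w ^ k * (w ^ 4 + 1) = w ^ k * (of_real (2 - 4 * (Im w)\<^sup>2) * w ^ 2)" by simp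
  then have "w ^ (k + 4) + w ^ k = of_real (2 - 4 * (Im w)\<^sup>2) * w ^ (k + 2)"
    by (simp only: power_add distrib_left mult_1_right mult.left_commute)
  from arg_cong[OF this, of Im] show ?thesis by (simp add: assms(2,3))
qed

text \<open>
  By the recurrence the imaginary part is \<open>- s * Q (s\<^sup>2)\<close>, where \<open>s = Im w\<close> is the sine of the angle and \<open>Q\<close>
  is the quintic polynomial above.
\<close>
lemma Im_odd_harmonics_neg:
  assumes w: "norm w = 1" "1 / 2 \<le> Im w"
  shows "Im (harmonic_poly odd_harmonics w) < 0"
proof -
  define s where "s = Im w"
  have n: "(Re w)\<^sup>2 + s\<^sup>2 = 1" using assms by (simp add: cmod_def s_def)
  have s1: "s \<le> 1" using abs_Im_le_cmod[of w] w(1) by (simp add: s_def)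
  note rec = Im_odd_power_rec[OF w(1), folded s_def]
  have I1: "Im (w ^ 1) = s" by (simp add: s_def)
  have I3: "Im (w ^ 3) = s * (3 - 4 * s\<^sup>2)"
  proof -
    have "Im (w ^ 3) = 3 * (Re w)\<^sup>2 * s - s ^ 3"
      by (simp add: s_def power2_eq_square power3_eq_cube algebra_simps)
    also have "(Re w)\<^sup>2 = 1 - s\<^sup>2" using n by simp
    finally show ?thesis by (simp add: power2_eq_square power3_eq_cube algebra_simps)
  qed
  have I5: "Im (w ^ 5) = (2 - 4 * s\<^sup>2) * Im (w ^ 3) - Im (w ^ 1)" by (rule rec) simp_all
  have I7: "Im (w ^ 7) = (2 - 4 * s\<^sup>2) * Im (w ^ 5) - Im (w ^ 3)" by (rule rec) simp_all
  have I9: "Im (w ^ 9) = (2 - 4 * s\<^sup>2) * Im (w ^ 7) - Im (w ^ 5)" by (rule rec) simp_all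
  have I11: "Im (w ^ 11) = (2 - 4 * s\<^sup>2) * Im (w ^ 9) - Im (w ^ 7)" by (rule rec) simp_all
  have "Im (harmonic_poly odd_harmonics w) = 
      Im (w ^ 3) / 3 + 3 * (Im (w ^ 5) / 5) + 4 * (Im (w ^ 7) / 7) + 3 * (Im (w ^ 9) / 9) + Im (w ^ 11) / 11"
    by (simp add: harmonic_poly_def odd_harmonics_def)
  also have "\<dots> = - s * (- 12 + 316 / 3 * s\<^sup>2 - 1648 / 5 * (s\<^sup>2) ^ 2 + 3392 / 7 * (s\<^sup>2) ^ 3
      - 1024 / 3 * (s\<^sup>2) ^ 4 + 1024 / 11 * (s\<^sup>2) ^ 5)"
    unfolding I11 I9 I7 I5 I3 I1 by (simp add: field_simps)
  also have "\<dots> < 0"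
  proof -
    have "(1 / 2)\<^sup>2 \<le> s\<^sup>2" "s\<^sup>2 \<le> 1\<^sup>2" using w(2) s1 unfolding s_def[symmetric] by (intro power_mono; simp)+
    then have "1 / 4 \<le> s\<^sup>2" "s\<^sup>2 \<le> 1" by (simp_all add: power2_eq_square)
    from quintic_pos[OF this] show ?thesis using w(2) unfolding s_def[symmetric]
      by (intro mult_neg_pos) auto
  qed
  finally show ?thesis .
qed

lemma norm_harmonic_poly_le:
  assumes "norm w = 1"
  shows "norm (harmonic_poly ks w) \<le> (\<Sum>k\<leftarrow>ks. 1 / real k)"
proof (induction ks)
  case (Cons k ks)
  have "norm (harmonic_poly (k # ks) w) \<le> norm (w ^ k / of_nat k) + norm (harmonic_poly ks w)"
    by (simp add: harmonic_poly_def norm_triangle_ineq)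
  also have "norm (w ^ k / of_nat k) = 1 / real k"
    using assms by (simp add: norm_divide norm_power)
  finally show ?case using Cons.IH by simp
qed (simp add: harmonic_poly_def)

lemma norm_harmonic_poly_odd_harmonics_le:
  assumes "norm w = 1"
  shows "norm (harmonic_poly odd_harmonics w) < 2"
proof -
  have "norm (harmonic_poly odd_harmonics w) \<le> (\<Sum>k\<leftarrow>odd_harmonics. 1 / real k)"
    by (rule norm_harmonic_poly_le[OF assms])
  also have "\<dots> < 2" by (simp add: odd_harmonics_def)
  finally show ?thesis .
qed

text \<open>
  The limiting difference between the residue 1 and a residue at which the two characters in use have
  the values \<open>z\<close> and \<open>u\<close>: the first character carries the frequency 1 twelve times, the second one the
  list \<open>odd_harmonics\<close>. The factor 12 lets the first summand outweigh the second one in the proof below.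
\<close>
definition race_gap :: "complex \<Rightarrow> complex \<Rightarrow> complex \<Rightarrow> complex" where
  "race_gap z u w = (cnj z - 1) * (12 * w) + (cnj u - 1) * harmonic_poly odd_harmonics w"

lemma cnj_harmonic_poly: "cnj (harmonic_poly ks w) = harmonic_poly ks (cnj w)"
  unfolding harmonic_poly_def by (induction ks) simp_all

lemma cnj_race_gap: "cnj (race_gap z u w) = race_gap (cnj z) (cnj u) (cnj w)"
  by (simp add: race_gap_def cnj_harmonic_poly)

text \<open>
  For a residue with \<open>z = 1\<close> and \<open>u = -1\<close> only the odd harmonics count, and they settle the arc
  \<open>Im w \<ge> 1 / 2\<close>. For the other two residues write \<open>w = c + \<i> * s\<close>. The larger one of the two first
  summands has imaginary part \<open>12 * (\<bar>Im z * c\<bar> - (1 - Re z) * s)\<close>, which is positive for \<open>s < 1 / 2\<close>. If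
  \<open>u = 1\<close>, there is nothing else; if \<open>z = \<plusminus>\<i>\<close>, it is at least 4, which dominates the odd harmonics.
\<close>
lemma race_gap_pos:
  assumes w: "norm w = 1" and z: "norm z = 1" and u: "norm u = 1"
    and cond: "(u = 1 \<and> z \<noteq> 1 \<and> - 1 / 2 \<le> Re z) \<or> z\<^sup>2 = -1"
  shows "0 < Im (race_gap 1 (-1) w) \<or> 0 < Im (race_gap z u w) \<or> 0 < Im (race_gap (cnj z) (cnj u) w)"
proof (cases "1 / 2 \<le> Im w")
  case True
  then show ?thesis using Im_odd_harmonics_neg[OF w] by (simp add: race_gap_def)
next
  case False
  define s c where "s = Im w" and "c = Re w"
  have s: "s < 1 / 2" using False by (simp add: s_def)
  have sc: "c\<^sup>2 + s\<^sup>2 = 1" using w by (simp add: cmod_def s_def c_def)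
  have zz: "(Re z)\<^sup>2 + (Im z)\<^sup>2 = 1" using z by (simp add: cmod_def)
  have Im1: "Im ((cnj z - 1) * (12 * w)) = 12 * (- (1 - Re z) * s - Im z * c)"
    and Im2: "Im ((cnj (cnj z) - 1) * (12 * w)) = 12 * (- (1 - Re z) * s + Im z * c)"
    by (simp_all add: s_def c_def algebra_simps)
  have s2: "s\<^sup>2 < 1 / 4" if "0 \<le> s"
    using power_strict_mono[OF s that, of 2] by (simp add: power2_eq_square)
  from cond show ?thesis
  proof (elim disjE conjE)
    assume u1: "u = 1" and z1: "z \<noteq> 1" and Re: "- 1 / 2 \<le> Re z"
    have "Re z \<noteq> 1" using zz z1 by (auto simp: complex_eq_iff)
    then have Re1: "Re z < 1" using complex_Re_le_cmod[of z] z by simp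
    have "(1 - Re z) * s < \<bar>Im z * c\<bar>"
    proof (cases "s < 0")
      case True
      then have "(1 - Re z) * s < 0" using Re1 by (intro mult_pos_neg) auto
      then show ?thesis by linarith
    next
      case False
      have "(1 - Re z) * s\<^sup>2 < 3 / 8"
      proof -
        have "(1 - Re z) * s\<^sup>2 < (1 - Re z) * (1 / 4)"
          using s2 False Re1 by (intro mult_strict_left_mono) auto
        then show ?thesis using Re by simp
      qed
      moreover have "3 / 8 \<le> (1 + Re z) * c\<^sup>2"
        using mult_mono[of "1 / 2" "1 + Re z" "3 / 4" "c\<^sup>2"] Re s2 False sc by simp
      ultimately have "(1 - Re z) * ((1 - Re z) * s\<^sup>2) < (1 - Re z) * ((1 + Re z) * c\<^sup>2)"
        using Re1 by (intro mult_strict_left_mono) auto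
      moreover have "(1 - Re z) * (1 + Re z) = (Im z)\<^sup>2"
        using zz by (simp add: power2_eq_square algebra_simps)
      ultimately have "(1 - Re z) * ((1 - Re z) * s\<^sup>2) < (Im z)\<^sup>2 * c\<^sup>2"
        by (metis mult.assoc)
      then have "((1 - Re z) * s)\<^sup>2 < \<bar>Im z * c\<bar>\<^sup>2"
        by (simp add: power_mult_distrib power2_eq_square[of "1 - Re z"] mult.assoc)
      then show ?thesis by (rule power2_less_imp_less) simp
    qed
    then have "0 < Im ((cnj z - 1) * (12 * w)) \<or> 0 < Im ((cnj (cnj z) - 1) * (12 * w))"
      unfolding Im1 Im2 by (cases "0 \<le> Im z * c") (simp_all add: algebra_simps)
    then show ?thesis unfolding race_gap_def u1 by simp
  next
    assume "z\<^sup>2 = -1"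
    then have z': "Re z = 0" "\<bar>Im z\<bar> = 1"
    proof -
      from \<open>z\<^sup>2 = -1\<close> have "(Re z)\<^sup>2 - (Im z)\<^sup>2 = -1" by (simp add: complex_eq_iff power2_eq_square)
      then have "(Re z)\<^sup>2 = 0" "(Im z)\<^sup>2 = 1" using zz by linarith+
      then show "Re z = 0" "\<bar>Im z\<bar> = 1" by (auto simp: power2_eq_1_iff)
    qed
    have small: "\<bar>Im ((cnj v - 1) * harmonic_poly odd_harmonics w)\<bar> < 4" if v: "norm v = 1" for v
    proof -
      have "norm (cnj v - 1) \<le> 2" using norm_triangle_ineq4[of "cnj v" 1] v by simp
      then have "norm (cnj v - 1) * norm (harmonic_poly odd_harmonics w) \<le> 2 * norm (harmonic_poly odd_harmonics w)"
        by (intro mult_right_mono) auto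
      then have "norm ((cnj v - 1) * harmonic_poly odd_harmonics w) < 4"
        using norm_harmonic_poly_odd_harmonics_le[OF w] by (simp add: norm_mult)
      then show ?thesis using abs_Im_le_cmod order_le_less_trans by blast
    qed
    have "s + 1 / 3 \<le> \<bar>c\<bar>"
    proof (cases "s < 0")
      case True
      have "\<bar>c\<bar> * \<bar>c\<bar> \<le> 1 * \<bar>c\<bar>" "\<bar>s\<bar> * \<bar>s\<bar> \<le> 1 * \<bar>s\<bar>"
        using abs_Im_le_cmod[of w] abs_Re_le_cmod[of w] w
        by (intro mult_right_mono; simp add: s_def c_def)+
      then have "1 \<le> \<bar>c\<bar> + \<bar>s\<bar>" using sc by (simp add: power2_eq_square)
      then show ?thesis using True by linarith
    next
      case False
      then have "(5 / 6)\<^sup>2 \<le> \<bar>c\<bar>\<^sup>2" using s2 sc by (simp add: power2_eq_square)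
      then have "5 / 6 \<le> \<bar>c\<bar>" by (rule power2_le_imp_le) simp
      then show ?thesis using s by linarith
    qed
    moreover have "\<bar>Im z * c\<bar> = \<bar>c\<bar>" using z'(2) by (simp add: abs_mult)
    ultimately have "s + 1 / 3 \<le> \<bar>Im z * c\<bar>" by simp
    then have "4 \<le> Im ((cnj z - 1) * (12 * w)) \<or> 4 \<le> Im ((cnj (cnj z) - 1) * (12 * w))"
      unfolding Im1 Im2 z'(1) by (simp only: diff_zero mult_minus_left mult_1) (cases "0 \<le> Im z * c"; simp)
    then show ?thesis
      using small[of u] small[of "cnj u"] u unfolding race_gap_def plus_complex.simps by auto
  qed
qed

lemma race_gap_neg:
  assumes w: "norm w = 1" and z: "norm z = 1" and u: "norm u = 1"
    and cond: "(u = 1 \<and> z \<noteq> 1 \<and> - 1 / 2 \<le> Re z) \<or> z\<^sup>2 = -1"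
  shows "Im (race_gap 1 (-1) w) < 0 \<or> Im (race_gap z u w) < 0 \<or> Im (race_gap (cnj z) (cnj u) w) < 0"
proof -
  have "Im (race_gap a b (cnj w)) = - Im (race_gap (cnj a) (cnj b) w)" for a b
    using cnj_race_gap[of "cnj a" "cnj b" w] by (metis complex_cnj_cnj cnj.simps(2))
  then show ?thesis using race_gap_pos[of "cnj w" z u] assms by auto
qed

section \<open>Asymptotics for systems of harmonic zeros\<close>

lemma of_real_powr_polar:
  assumes "x > 0"
  shows "complex_of_real x powr z = of_real (x powr Re z) * cis (Im z * ln x)"
  using assms by (simp add: powr_def Ln_of_real exp_eq_polar)

text \<open>
  By l'Hospital's rule: the quotient of the derivatives is of the order of \<open>1 / ln x\<close>.
\<close>
lemma log_integral_negligible: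
  fixes s :: real
  assumes s: "s > 0"
  shows "((\<lambda>x. integral {2..x} (\<lambda>t. t powr (s - 1) / (ln t)\<^sup>2) / (x powr s / ln x)) \<longlongrightarrow> 0) at_top"
proof -
  let ?h = "\<lambda>t::real. t powr (s - 1) / (ln t)\<^sup>2"
  show ?thesis
  proof (rule lhospital_at_top_at_top[where f' = ?h and
        g' = "\<lambda>x. s * x powr (s - 1) / ln x - x powr (s - 1) / (ln x)\<^sup>2"])
    show "filterlim (\<lambda>x. x powr s / ln x) at_top at_top"
      using s by real_asymp
    show "\<forall>\<^sub>F x in at_top. s * x powr (s - 1) / ln x - x powr (s - 1) / (ln x)\<^sup>2 \<noteq> 0"
    proof -
      have "\<forall>\<^sub>F x in at_top. x > 1 \<and> ln x > 1 / s"
        using eventually_gt_at_top[of "1 :: real"] filterlim_at_top_dense[THEN iffD1, OF ln_at_top, rule_format]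
        by (intro eventually_conj) auto
      then show ?thesis
      proof eventually_elim
        case (elim x)
        then have "s * ln x \<noteq> 1" "ln x > 0" using s by (auto simp: field_simps)
        moreover have "s * x powr (s - 1) / ln x - x powr (s - 1) / (ln x)\<^sup>2 = x powr (s - 1) * (s * ln x - 1) / (ln x)\<^sup>2"
          using elim by (simp add: field_simps power2_eq_square)
        ultimately show ?case using elim by simp
      qed
    qed
    show "\<forall>\<^sub>F x in at_top. ((\<lambda>x. integral {2..x} ?h) has_real_derivative ?h x) (at x)"
      using eventually_gt_at_top[of "2 :: real"]
    proof eventually_elim
      case (elim x)
      have "continuous_on {2..x + 1} ?h" by (intro continuous_intros) auto
      then have "((\<lambda>x. integral {2..x} ?h) has_real_derivative ?h x) (at x within {2..x + 1})"
        using elim by (intro integral_has_real_derivative) auto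
      then show ?case using elim by (simp add: at_within_Icc_at)
    qed
    show "\<forall>\<^sub>F x in at_top. ((\<lambda>x. x powr s / ln x) has_real_derivative
        s * x powr (s - 1) / ln x - x powr (s - 1) / (ln x)\<^sup>2) (at x)"
      using eventually_gt_at_top[of "2 :: real"]
    proof eventually_elim
      case (elim x)
      have "x powr s = x powr (s - 1) * x" using elim powr_add[of x "s - 1" 1] by simp
      then show ?case using elim
        by (auto intro!: derivative_eq_intros simp: field_simps power2_eq_square)
    qed
    show "((\<lambda>x. ?h x / (s * x powr (s - 1) / ln x - x powr (s - 1) / (ln x)\<^sup>2)) \<longlongrightarrow> 0) at_top"
      using s by real_asymp
  qed
qed

lemma zero_term_asymptotics:
  assumes "Re r > 0"
  shows "((\<lambda>x. zero_term x r / of_real (x powr Re r / ln x) - cis (Im r * ln x) / r) \<longlongrightarrow> 0) at_top"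
proof -
  let ?h = "\<lambda>t. t powr (Re r - 1) / (ln t)\<^sup>2"
  let ?H = "\<lambda>t::real. of_real t powr r / of_real (t * (ln t)\<^sup>2)"
  show ?thesis
  proof (rule Lim_null_comparison)
    show "((\<lambda>x. 1 / norm r * (integral {2..x} ?h / (x powr Re r / ln x))) \<longlongrightarrow> 0) at_top"
      using tendsto_mult_right_zero[OF log_integral_negligible[OF assms]] .
    show "\<forall>\<^sub>F x in at_top. norm (zero_term x r / of_real (x powr Re r / ln x) - cis (Im r * ln x) / r)
        \<le> 1 / norm r * (integral {2..x} ?h / (x powr Re r / ln x))"
      using eventually_gt_at_top[of "2 :: real"]
    proof eventually_elim
      case (elim x)
      have r: "r \<noteq> 0" using assms by auto
      have g: "x powr Re r / ln x > 0" and l: "ln x > 0" using elim by simp_all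
      have main: "of_real x powr r / (r * of_real (ln x)) / of_real (x powr Re r / ln x) = cis (Im r * ln x) / r"
        using elim l by (simp add: of_real_powr_polar field_simps)
      then have "zero_term x r / of_real (x powr Re r / ln x) - cis (Im r * ln x) / r
          = 1 / r * integral {2..x} ?H / of_real (x powr Re r / ln x)"
        by (simp only: zero_term_def add_divide_distrib main add_diff_cancel_left')
      also have "norm \<dots> = 1 / norm r * (norm (integral {2..x} ?H) / (x powr Re r / ln x))"
        using g elim by (simp add: norm_mult norm_divide)
      also have "\<dots> \<le> 1 / norm r * (integral {2..x} ?h / (x powr Re r / ln x))"
      proof -
        have "norm (integral {2..x} ?H) \<le> integral {2..x} ?h"
        proof (rule integral_norm_bound_integral)
          show "?H integrable_on {2..x}"
            by (intro integrable_continuous_interval continuous_intros) auto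
          show "?h integrable_on {2..x}"
            by (intro integrable_continuous_interval continuous_intros) auto
          show "norm (?H t) \<le> ?h t" if "t \<in> {2..x}" for t
            using that by (simp add: norm_divide norm_mult norm_power norm_powr_real_powr powr_diff)
        qed
        then show ?thesis using g by (intro mult_left_mono divide_right_mono) auto
      qed
      finally show ?case .
    qed
  qed
qed

lemma sum_count_list:
  fixes f :: "'a \<Rightarrow> 'b :: comm_semiring_1"
  assumes "finite S" "set xs \<subseteq> S"
  shows "(\<Sum>x\<in>S. of_nat (count_list xs x) * f x) = (\<Sum>x\<leftarrow>xs. f x)"
  using assms(2)
proof (induction xs)
  case (Cons y xs)
  have "(\<Sum>x\<in>S. of_nat (count_list (y # xs) x) * f x)
      = (\<Sum>x\<in>S. (if y = x then f x else 0) + of_nat (count_list xs x) * f x)"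
    by (intro sum.cong) (auto simp: algebra_simps)
  also have "\<dots> = f y + (\<Sum>x\<leftarrow>xs. f x)"
    using Cons assms(1) by (simp add: sum.distrib)
  finally show ?case by simp
qed simp

text \<open>
  The real part is an arbitrary choice strictly between \<open>1 / 2\<close> and 1.
\<close>
definition harmonic_zero :: "real \<Rightarrow> nat \<Rightarrow> complex" where
  "harmonic_zero \<gamma> k = Complex (3 / 4) (real k * \<gamma>)"

definition harmonic_system :: "((nat \<Rightarrow> complex) \<Rightarrow> nat list) \<Rightarrow> real \<Rightarrow> zero_system" where
  "harmonic_system K \<gamma> chi = Fin_Seq (map (harmonic_zero \<gamma>) (K chi))"

text \<open>
  The limit of \<open>\<gamma>\<close> times \<open>zero_gap\<close> below as \<open>\<gamma>\<close> tends to infinity, except for a factor \<open>- \<i>\<close>: the zero at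
  height \<open>k * \<gamma>\<close> becomes \<open>\<i> * k * \<gamma>\<close>. It no longer depends on the real part of the zeros.
\<close>
definition limit_gap :: "nat \<Rightarrow> ((nat \<Rightarrow> complex) \<Rightarrow> nat list) \<Rightarrow> nat \<Rightarrow> complex \<Rightarrow> complex" where
  "limit_gap q K a w = (\<Sum>chi\<in>nonprincipal_characters q. (cnj (chi a) - 1) * harmonic_poly (K chi) w)"

definition zero_gap :: "nat \<Rightarrow> ((nat \<Rightarrow> complex) \<Rightarrow> nat list) \<Rightarrow> real \<Rightarrow> nat \<Rightarrow> complex \<Rightarrow> complex" where
  "zero_gap q K \<gamma> a w = (\<Sum>chi\<in>nonprincipal_characters q.
     (cnj (chi a) - 1) * (\<Sum>k\<leftarrow>K chi. w ^ k / harmonic_zero \<gamma> k))"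

lemma finite_nonprincipal_characters:
  assumes "q > 0"
  shows "finite (nonprincipal_characters q)"
  using finite_dirichlet_characters[OF assms] by (rule finite_subset[rotated]) (auto simp: nonprincipal_characters_def)

lemma zero_sum_harmonic_system:
  assumes "\<gamma> > 0" "0 \<notin> set (K chi)"
  shows "(\<Sum>\<^sub>\<infinity>\<rho>\<in>seq_elems (harmonic_system K \<gamma> chi).
       of_real (zero_weight \<rho>) * of_nat (seq_count (harmonic_system K \<gamma> chi) \<rho>) * zero_term x \<rho>)
     = (\<Sum>k\<leftarrow>K chi. zero_term x (harmonic_zero \<gamma> k))"
proof -
  let ?zs = "map (harmonic_zero \<gamma>) (K chi)"
  have weight: "zero_weight \<rho> = 1" if \<rho>: "\<rho> \<in> set ?zs" for \<rho>
  proof -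
    obtain k where "k \<in> set (K chi)" "\<rho> = harmonic_zero \<gamma> k" using \<rho> by auto
    then have "Im \<rho> \<noteq> 0" using assms by (cases "k = 0") (auto simp: harmonic_zero_def)
    then show ?thesis by (simp add: zero_weight_def)
  qed
  have "(\<Sum>\<^sub>\<infinity>\<rho>\<in>seq_elems (harmonic_system K \<gamma> chi).
       of_real (zero_weight \<rho>) * of_nat (seq_count (harmonic_system K \<gamma> chi) \<rho>) * zero_term x \<rho>)
     = (\<Sum>\<rho>\<in>set ?zs. of_real (zero_weight \<rho>) * of_nat (count_list ?zs \<rho>) * zero_term x \<rho>)"
    unfolding harmonic_system_def seq_elems.simps seq_count.simps by (rule infsum_finite) simp
  also have "\<dots> = (\<Sum>\<rho>\<in>set ?zs. of_nat (count_list ?zs \<rho>) * zero_term x \<rho>)"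
    by (rule sum.cong) (simp_all only: weight of_real_1 mult_1)
  also have "\<dots> = (\<Sum>\<rho>\<leftarrow>?zs. zero_term x \<rho>)" by (rule sum_count_list) simp_all
  finally show ?thesis by (simp add: o_def)
qed

text \<open>
  The terms with the number of primes cancel, every zero contributes its leading term, and
  \<open>cis (\<gamma> * ln x) ^ k\<close> is the oscillating factor of \<open>x\<close> to the power \<open>harmonic_zero \<gamma> k\<close>.
\<close>
lemma P_fun_gap_asymptotics:
  assumes \<gamma>: "\<gamma> > 0" and K: "\<And>chi. chi \<in> nonprincipal_characters q \<Longrightarrow> 0 \<notin> set (K chi)"
  defines "P \<equiv> P_fun q (harmonic_system K \<gamma>)"
  shows "((\<lambda>x. (P 1 x - P a x) / (x powr (3 / 4) / ln x)
      - 2 / real (totient q) * Re (zero_gap q K \<gamma> a (cis (\<gamma> * ln x)))) \<longlongrightarrow> 0) at_top"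
proof -
  define Z where "Z = (\<lambda>chi x. \<Sum>k\<leftarrow>K chi. zero_term x (harmonic_zero \<gamma> k))"
  define g where "g = (\<lambda>x::real. x powr (3 / 4) / ln x)"
  define V where "V = (\<lambda>chi x. \<Sum>k\<leftarrow>K chi. cis (\<gamma> * ln x) ^ k / harmonic_zero \<gamma> k)"
  have summand: "((\<lambda>x. zero_term x (harmonic_zero \<gamma> k) / of_real (g x)
      - cis (\<gamma> * ln x) ^ k / harmonic_zero \<gamma> k) \<longlongrightarrow> 0) at_top" for k
    using zero_term_asymptotics[of "harmonic_zero \<gamma> k"]
    by (simp add: harmonic_zero_def g_def Complex.DeMoivre mult.assoc)
  have "((\<lambda>x. (\<Sum>k\<leftarrow>ks. zero_term x (harmonic_zero \<gamma> k)) / of_real (g x)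
      - (\<Sum>k\<leftarrow>ks. cis (\<gamma> * ln x) ^ k / harmonic_zero \<gamma> k)) \<longlongrightarrow> 0) at_top" for ks
  proof (induction ks)
    case (Cons k ks)
    from tendsto_add[OF summand[of k] Cons.IH] show ?case
      by (simp add: add_divide_distrib algebra_simps)
  qed simp
  then have ZV: "((\<lambda>x. Z chi x / of_real (g x) - V chi x) \<longlongrightarrow> 0) at_top" for chi
    unfolding Z_def V_def .
  have "((\<lambda>x. 2 / real (totient q) * Re (\<Sum>chi\<in>nonprincipal_characters q.
      (cnj (chi a) - 1) * (Z chi x / of_real (g x) - V chi x))) \<longlongrightarrow>
      2 / real (totient q) * Re (\<Sum>chi\<in>nonprincipal_characters q. (cnj (chi a) - 1) * 0)) at_top"
    by (intro tendsto_intros ZV)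
  moreover have "2 / real (totient q) * Re (\<Sum>chi\<in>nonprincipal_characters q.
      (cnj (chi a) - 1) * (Z chi x / of_real (g x) - V chi x))
    = (P 1 x - P a x) / g x - 2 / real (totient q) * Re (zero_gap q K \<gamma> a (cis (\<gamma> * ln x)))" for x
  proof -
    have P: "P b x = - (2 / real (totient q)) * Re (\<Sum>chi\<in>nonprincipal_characters q. cnj (chi b) * Z chi x)
      + real (prime_count x) / real (totient q)" for b
    proof -
      have "(\<Sum>chi\<in>nonprincipal_characters q. conj_character chi b *
             (\<Sum>\<^sub>\<infinity>\<rho>\<in>seq_elems (harmonic_system K \<gamma> chi).
                of_real (zero_weight \<rho>) * of_nat (seq_count (harmonic_system K \<gamma> chi) \<rho>) * zero_term x \<rho>))
          = (\<Sum>chi\<in>nonprincipal_characters q. cnj (chi b) * Z chi x)"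
        by (intro sum.cong refl) (simp only: zero_sum_harmonic_system[OF \<gamma> K] Z_def conj_character_def)
      then show ?thesis unfolding P_def P_fun_def by (simp only:)
    qed
    have one: "cnj (chi 1) = 1" if "chi \<in> nonprincipal_characters q" for chi
      using dirichlet_character_one[of q chi] that by (simp add: nonprincipal_characters_def)
    have gap: "zero_gap q K \<gamma> a (cis (\<gamma> * ln x))
        = (\<Sum>chi\<in>nonprincipal_characters q. (cnj (chi a) - 1) * V chi x)"
      by (simp only: zero_gap_def V_def)
    have affine: "- c * u + d - (- c * v + d) = c * (v - u)" for c d u v :: real
      by (simp add: algebra_simps)
    have "(\<Sum>chi\<in>nonprincipal_characters q. (cnj (chi a) - 1) * Z chi x)
        = (\<Sum>chi\<in>nonprincipal_characters q. cnj (chi a) * Z chi x) -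
          (\<Sum>chi\<in>nonprincipal_characters q. cnj (chi 1) * Z chi x)"
      unfolding sum_subtractf[symmetric]
      by (intro sum.cong refl) (simp only: one algebra_simps mult_1)
    then have "P 1 x - P a x = 2 / real (totient q) *
        Re (\<Sum>chi\<in>nonprincipal_characters q. (cnj (chi a) - 1) * Z chi x)"
      unfolding P affine by (simp only: minus_complex.sel)
    moreover have "(\<Sum>chi\<in>nonprincipal_characters q. (cnj (chi a) - 1) * (Z chi x / of_real (g x) - V chi x))
      = (\<Sum>chi\<in>nonprincipal_characters q. (cnj (chi a) - 1) * Z chi x) / of_real (g x)
        - zero_gap q K \<gamma> a (cis (\<gamma> * ln x))"
      unfolding gap sum_divide_distrib sum_subtractf[symmetric]
      by (intro sum.cong refl) (simp add: algebra_simps)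
    ultimately show ?thesis by (simp add: Re_divide_of_real right_diff_distrib)
  qed
  ultimately show ?thesis unfolding g_def by simp
qed

lemma zero_gap_approx:
  assumes q: "q > 0" and \<gamma>: "\<gamma> > 0" and w: "norm w = 1" and a: "coprime a q"
    and K: "\<And>chi. chi \<in> nonprincipal_characters q \<Longrightarrow> 0 \<notin> set (K chi)"
  shows "\<bar>\<gamma> * Re (zero_gap q K \<gamma> a w) - Im (limit_gap q K a w)\<bar>
    \<le> 2 * (\<Sum>chi\<in>nonprincipal_characters q. real (length (K chi))) / \<gamma>"
proof -
  have summand: "norm (of_real \<gamma> * (w ^ k / harmonic_zero \<gamma> k) + \<i> * (w ^ k / of_nat k)) \<le> 1 / \<gamma>"
    if "k > 0" for k
  proof -
    let ?r = "harmonic_zero \<gamma> k"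
    have k: "1 \<le> real k" using that by simp
    have "1 * \<gamma> \<le> real k * \<gamma>" using k \<gamma> by (intro mult_right_mono) auto
    also have "\<dots> \<le> \<bar>Im ?r\<bar>" by (simp add: harmonic_zero_def)
    also have "\<dots> \<le> norm ?r" by (rule abs_Im_le_cmod)
    finally have r: "\<gamma> \<le> norm ?r" by simp
    then have r0: "?r \<noteq> 0" using \<gamma> by auto
    have rr: "?r = 3 / 4 + \<i> * of_nat k * of_real \<gamma>"
      by (simp add: harmonic_zero_def complex_eq_iff)
    have "of_real \<gamma> * (w ^ k / ?r) + \<i> * (w ^ k / of_nat k)
        = w ^ k * (of_nat k * of_real \<gamma> + \<i> * ?r) / (of_nat k * ?r)"
      using r0 that by (simp add: field_simps)
    also have "of_nat k * of_real \<gamma> + \<i> * ?r = \<i> * (3 / 4)"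
      unfolding rr by (simp add: algebra_simps)
    finally have "norm (of_real \<gamma> * (w ^ k / ?r) + \<i> * (w ^ k / of_nat k)) = 3 / 4 / (real k * norm ?r)"
      using w by (simp add: norm_mult norm_divide norm_power)
    also have "\<dots> \<le> 1 / (1 * \<gamma>)"
      using r k \<gamma> by (intro frac_le mult_mono) auto
    finally show ?thesis by simp
  qed
  have list: "norm (of_real \<gamma> * (\<Sum>k\<leftarrow>ks. w ^ k / harmonic_zero \<gamma> k) + \<i> * harmonic_poly ks w)
      \<le> real (length ks) / \<gamma>" if "0 \<notin> set ks" for ks
    using that
  proof (induction ks)
    case (Cons k ks)
    have "norm (of_real \<gamma> * (\<Sum>k\<leftarrow>k # ks. w ^ k / harmonic_zero \<gamma> k) + \<i> * harmonic_poly (k # ks) w)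
      \<le> norm (of_real \<gamma> * (w ^ k / harmonic_zero \<gamma> k) + \<i> * (w ^ k / of_nat k))
        + norm (of_real \<gamma> * (\<Sum>k\<leftarrow>ks. w ^ k / harmonic_zero \<gamma> k) + \<i> * harmonic_poly ks w)"
      by (rule order_trans[OF _ norm_triangle_ineq]) (simp add: harmonic_poly_def algebra_simps)
    also have "\<dots> \<le> 1 / \<gamma> + real (length ks) / \<gamma>"
      using Cons by (intro add_mono summand) auto
    finally show ?case by (simp add: add_divide_distrib)
  qed (simp add: harmonic_poly_def)
  have "\<bar>\<gamma> * Re (zero_gap q K \<gamma> a w) - Im (limit_gap q K a w)\<bar>
      = \<bar>Re (of_real \<gamma> * zero_gap q K \<gamma> a w + \<i> * limit_gap q K a w)\<bar>"
    by simp
  also have "\<dots> \<le> norm (of_real \<gamma> * zero_gap q K \<gamma> a w + \<i> * limit_gap q K a w)"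
    by (rule abs_Re_le_cmod)
  also have "of_real \<gamma> * zero_gap q K \<gamma> a w + \<i> * limit_gap q K a w
    = (\<Sum>chi\<in>nonprincipal_characters q. (cnj (chi a) - 1) *
        (of_real \<gamma> * (\<Sum>k\<leftarrow>K chi. w ^ k / harmonic_zero \<gamma> k) + \<i> * harmonic_poly (K chi) w))"
    unfolding zero_gap_def limit_gap_def sum_distrib_left sum.distrib[symmetric]
    by (intro sum.cong refl) (simp add: algebra_simps)
  also have "norm \<dots> \<le> (\<Sum>chi\<in>nonprincipal_characters q. 2 * (real (length (K chi)) / \<gamma>))"
  proof (rule sum_norm_le)
    fix chi assume chi: "chi \<in> nonprincipal_characters q"
    have "norm (chi a) = 1"
      using dirichlet_character_norm[OF q _ a] chi by (simp add: nonprincipal_characters_def)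
    then have "norm (cnj (chi a) - 1) \<le> 2" using norm_triangle_ineq4[of "cnj (chi a)" 1] by simp
    then show "norm ((cnj (chi a) - 1) *
        (of_real \<gamma> * (\<Sum>k\<leftarrow>K chi. w ^ k / harmonic_zero \<gamma> k) + \<i> * harmonic_poly (K chi) w))
        \<le> 2 * (real (length (K chi)) / \<gamma>)"
      unfolding norm_mult using list[OF K[OF chi]] by (intro mult_mono) auto
  qed
  also have "\<dots> = 2 * (\<Sum>chi\<in>nonprincipal_characters q. real (length (K chi))) / \<gamma>"
    by (simp add: sum_distrib_left sum_divide_distrib)
  finally show ?thesis .
qed

section \<open>Barriers from sign changes on the unit circle\<close>

text \<open>
  The sum of the positive parts is continuous and positive, hence bounded below by a positive
  constant; at each point one of the functions has at least the average size.
\<close>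
lemma uniformly_positive_family:
  fixes f :: "'a \<Rightarrow> 'b :: topological_space \<Rightarrow> real"
  assumes S: "compact S" and D: "finite D" and cont: "\<And>a. a \<in> D \<Longrightarrow> continuous_on S (f a)"
    and pos: "\<And>w. w \<in> S \<Longrightarrow> \<exists>a\<in>D. 0 < f a w"
  shows "\<exists>c>0. \<forall>w\<in>S. \<exists>a\<in>D. c \<le> f a w"
proof (cases "S = {}")
  case True
  then show ?thesis by (intro exI[of _ 1]) simp
next
  case False
  define h where "h = (\<lambda>w. \<Sum>a\<in>D. max 0 (f a w))"
  have "continuous_on S h"
    unfolding h_def by (intro continuous_on_sum continuous_on_max continuous_on_const cont)
  then obtain v where v: "v \<in> S" "\<And>w. w \<in> S \<Longrightarrow> h v \<le> h w"
    using continuous_attains_inf[OF S False] by blast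
  obtain a where a: "a \<in> D" "0 < f a v" using pos[OF v(1)] by blast
  have "0 < max 0 (f a v)" using a(2) by simp
  also have "\<dots> \<le> h v" unfolding h_def using a(1) D by (intro member_le_sum) auto
  finally have hv: "0 < h v" .
  have card: "real (card D) > 0" using a(1) D by (auto simp: card_gt_0_iff)
  define c where "c = h v / card D"
  have "c > 0" using hv card by (simp add: c_def)
  moreover have "\<exists>a\<in>D. c \<le> f a w" if "w \<in> S" for w
  proof (rule ccontr)
    assume "\<not> (\<exists>a\<in>D. c \<le> f a w)"
    then have "max 0 (f a w) < c" if "a \<in> D" for a
      using that \<open>c > 0\<close> by auto
    then have "h w < of_nat (card D) * c"
      unfolding h_def using card by (intro sum_bounded_above_strict) auto
    also have "\<dots> = h v" using card by (simp add: c_def)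
    finally show False using v(2)[OF that] by simp
  qed
  ultimately show ?thesis by blast
qed

lemma not_for_arbitrarily_large:
  assumes "\<forall>\<^sub>F x in at_top. \<not> A x"
  shows "\<not> for_arbitrarily_large A"
proof -
  obtain N where N: "\<And>x. x \<ge> N \<Longrightarrow> \<not> A x"
    using assms unfolding eventually_at_top_linorder by blast
  have "x \<le> N" if "A x" for x using that N[of x] by linarith
  then show ?thesis unfolding for_arbitrarily_large_def by (auto intro: bdd_aboveI[of _ N])
qed

lemma similar_gap_asymptotics:
  assumes "similar q \<beta> F P" and "a \<in> totatives q" and "b \<in> totatives q"
  shows "((\<lambda>x. (F a x - F b x) / (x powr \<beta> / ln x) - (P a x - P b x) / (x powr \<beta> / ln x)) \<longlongrightarrow> 0) at_top"
proof -
  have "((\<lambda>x. (F a x - P a x) / (x powr \<beta> / ln x)) \<longlongrightarrow> 0) at_top" if "a \<in> totatives q" for a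
  proof -
    have "(\<lambda>x. \<bar>F a x - P a x\<bar>) \<in> o(\<lambda>x. x powr \<beta> / ln x)"
      using assms(1) that unfolding similar_def by blast
    then have "(\<lambda>x. F a x - P a x) \<in> o(\<lambda>x. x powr \<beta> / ln x)" by simp
    then show ?thesis by (rule smalloD_tendsto)
  qed
  from tendsto_diff[OF this[OF assms(2)] this[OF assms(3)]] show ?thesis
    by (simp add: diff_divide_distrib algebra_simps)
qed

lemma R_harmonic_system:
  assumes "chi \<in> nonprincipal_characters q" "K chi \<noteq> []"
  shows "R_minus q (harmonic_system K \<gamma>) = ereal (3 / 4)"
    and "R_plus q (harmonic_system K \<gamma>) = ereal (3 / 4)"
proof -
  let ?S = "system_elems q (harmonic_system K \<gamma>)"
  have ne: "?S \<noteq> {}"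
    using assms unfolding system_elems_def harmonic_system_def by auto
  have const: "ereal (Re \<rho>) = ereal (3 / 4)" if "\<rho> \<in> ?S" for \<rho>
    using that unfolding system_elems_def harmonic_system_def by (auto simp: harmonic_zero_def)
  show "R_minus q (harmonic_system K \<gamma>) = ereal (3 / 4)"
    unfolding R_minus_def by (rule INF_eq_const[OF ne const])
  show "R_plus q (harmonic_system K \<gamma>) = ereal (3 / 4)"
    unfolding R_plus_def by (rule SUP_eq_const[OF ne const])
qed

lemma is_system_harmonic_system:
  assumes q: "q > 0" and \<gamma>: "\<gamma> > 0" and K: "\<And>chi. 0 \<notin> set (K chi)"
    and ne: "chi \<in> nonprincipal_characters q" "K chi \<noteq> []"
  shows "is_system q (harmonic_system K \<gamma>)"
proof -
  have Im: "Im \<rho> > 0" if \<rho>: "\<rho> \<in> seq_elems (harmonic_system K \<gamma> chi)" for \<rho> chi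
  proof -
    obtain k where "k \<in> set (K chi)" "\<rho> = harmonic_zero \<gamma> k"
      using \<rho> by (auto simp: harmonic_system_def)
    then show ?thesis using K[of chi] \<gamma> by (cases "k = 0") (auto simp: harmonic_zero_def)
  qed
  have "seq_count (harmonic_system K \<gamma> chi) \<rho> = 0" if "Im \<rho> = 0" for chi \<rho>
    using Im[of \<rho> chi] that by (auto simp: harmonic_system_def count_list_0_iff)
  moreover have "finite (SIGMA chi:nonprincipal_characters q. seq_elems (harmonic_system K \<gamma> chi))"
    by (intro finite_SigmaI finite_nonprincipal_characters[OF q]) (simp add: harmonic_system_def)
  moreover have "1 / 2 < ereal (3 / 4)" "ereal (3 / 4) \<le> 1"
    by (simp_all add: one_ereal_def numeral_eq_ereal divide_ereal_def)
  ultimately show ?thesis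
    unfolding is_system_def R_harmonic_system[where K = K, OF ne]
    using Im by (auto simp: system_elems_def less_imp_le harmonic_system_def intro: summable_on_finite)
qed

lemma eventually_sign_of_limit_gap:
  assumes q: "q > 0" and \<gamma>: "\<gamma> > 0" and K: "\<And>chi. 0 \<notin> set (K chi)"
    and a: "a \<in> totatives q" and c: "c > 0" 
    and \<gamma>_large: "2 * (\<Sum>chi\<in>nonprincipal_characters q. real (length (K chi))) / \<gamma> \<le> c / 2"
    and F: "similar q (3 / 4) F (P_fun q (harmonic_system K \<gamma>))"
  shows "\<forall>\<^sub>F x in at_top.
    (c \<le> Im (limit_gap q K a (cis (\<gamma> * ln x))) \<longrightarrow> F a x < F 1 x) \<and>
    (Im (limit_gap q K a (cis (\<gamma> * ln x))) \<le> - c \<longrightarrow> F 1 x < F a x)"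
proof -
  define \<phi> where "\<phi> = real (totient q)"
  have \<phi>: "\<phi> > 0" using q by (simp add: \<phi>_def)
  have one: "1 \<in> totatives q" using q by (simp add: totatives_def)
  define E where "E = (\<lambda>x. Re (zero_gap q K \<gamma> a (cis (\<gamma> * ln x))))"
  have cop: "coprime a q" using a by (simp add: totatives_def)
  have "((\<lambda>x. (F 1 x - F a x) / (x powr (3 / 4) / ln x) - 2 / \<phi> * E x) \<longlongrightarrow> 0) at_top"
    using tendsto_add[OF similar_gap_asymptotics[OF F one a] P_fun_gap_asymptotics[where q = q and K = K and a = a, OF \<gamma> K]]
    by (simp add: E_def \<phi>_def algebra_simps)
  then have "\<forall>\<^sub>F x in at_top. dist ((F 1 x - F a x) / (x powr (3 / 4) / ln x) - 2 / \<phi> * E x) 0 < c / (\<phi> * \<gamma>)"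
    using c \<phi> \<gamma> by (intro tendstoD) auto
  then show ?thesis
    using eventually_gt_at_top[of "1 :: real"]
  proof eventually_elim
    case (elim x)
    define g where "g = x powr (3 / 4) / ln x"
    let ?L = "Im (limit_gap q K a (cis (\<gamma> * ln x)))"
    have g: "g > 0" using elim(2) by (simp add: g_def)
    have approx: "\<bar>\<gamma> * E x - ?L\<bar> \<le> c / 2"
      unfolding E_def
      by (rule order_trans[OF zero_gap_approx[where K = K, OF q \<gamma> _ cop K] \<gamma>_large]) simp
    have close: "\<bar>(F 1 x - F a x) / g - 2 / \<phi> * E x\<bar> < c / (\<phi> * \<gamma>)"
      using elim(1) by (simp add: g_def)
    have E: "2 / \<phi> * E x = 2 * (\<gamma> * E x) / (\<phi> * \<gamma>)" using \<gamma> by simp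
    show ?case
    proof (intro conjI impI)
      assume "c \<le> ?L"
      then have "c \<le> 2 * (\<gamma> * E x)" using approx by linarith
      then have "c / (\<phi> * \<gamma>) \<le> 2 / \<phi> * E x"
        unfolding E using \<phi> \<gamma> by (intro divide_right_mono) auto
      then have "0 < (F 1 x - F a x) / g" using close by linarith
      then show "F a x < F 1 x" using g by (simp add: zero_less_divide_iff)
    next
      assume "?L \<le> - c"
      then have "2 * (\<gamma> * E x) \<le> - c" using approx by linarith
      then have "2 / \<phi> * E x \<le> (- c) / (\<phi> * \<gamma>)"
        unfolding E using \<phi> \<gamma> by (intro divide_right_mono) auto
      then have "(F 1 x - F a x) / g < 0" using close by linarith
      then show "F 1 x < F a x" using g by (simp add: divide_less_0_iff)
    qed
  qed
qed

text \<open>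
  The reduction of the race to the unit circle. If at every point of the circle the limiting
  differences of the residues in \<open>D\<close> take both signs, then by compactness they do so with absolute values
  bounded below by some \<open>c\<close>. For large \<open>\<gamma>\<close> the true differences are within \<open>c / 2\<close> of the limiting ones, and the
  error terms are eventually negligible, so that 1 is neither first nor last for large \<open>x\<close>.
\<close>
theorem harmonic_system_barrier:
  assumes q: "q > 0" and K: "\<And>chi. 0 \<notin> set (K chi)" and D: "D \<subseteq> totatives q"
    and pos: "\<And>w. norm w = 1 \<Longrightarrow> \<exists>a\<in>D. 0 < Im (limit_gap q K a w)"
    and neg: "\<And>w. norm w = 1 \<Longrightarrow> \<exists>a\<in>D. Im (limit_gap q K a w) < 0"
  obtains \<gamma> where "\<gamma> > \<tau>" "\<gamma> > 0" "is_system q (harmonic_system K \<gamma>)"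
    "barrier q (harmonic_system K \<gamma>) (\<lambda>F. for_arbitrarily_large (\<lambda>x. \<forall>a\<in>D. F 1 x < F a x))"
    "barrier q (harmonic_system K \<gamma>) (\<lambda>F. for_arbitrarily_large (\<lambda>x. \<forall>a\<in>D. F 1 x > F a x))"
proof -
  have fin: "finite D" using D by (rule finite_subset) simp
  have cont: "continuous_on S (\<lambda>w. limit_gap q K a w)" for a S
  proof -
    have "continuous_on S (harmonic_poly ks)" for ks
      unfolding harmonic_poly_def divide_inverse
      by (induction ks) (auto intro!: continuous_intros)
    then show ?thesis unfolding limit_gap_def by (intro continuous_intros) 
  qed
  have cont_Im: "continuous_on (sphere 0 1) (\<lambda>w. Im (limit_gap q K a w))" for a
    by (intro continuous_on_Im cont)
  have "\<exists>c>0. \<forall>w\<in>sphere 0 1. \<exists>a\<in>D. c \<le> Im (limit_gap q K a w)"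
    by (rule uniformly_positive_family[OF compact_sphere fin cont_Im]) (simp add: pos)
  then obtain c1 where c1: "c1 > 0" "\<And>w. w \<in> sphere 0 1 \<Longrightarrow> \<exists>a\<in>D. c1 \<le> Im (limit_gap q K a w)"
    by blast
  have "\<exists>c>0. \<forall>w\<in>sphere 0 1. \<exists>a\<in>D. c \<le> - Im (limit_gap q K a w)"
    by (rule uniformly_positive_family[OF compact_sphere fin continuous_on_minus[OF cont_Im]]) (simp add: neg)
  then obtain c2 where c2: "c2 > 0" "\<And>w. w \<in> sphere 0 1 \<Longrightarrow> \<exists>a\<in>D. c2 \<le> - Im (limit_gap q K a w)"
    by blast
  define c where "c = min c1 c2"
  have c: "c > 0" using c1 c2 by (simp add: c_def)
  define M where "M = (\<Sum>chi\<in>nonprincipal_characters q. real (length (K chi)))"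
  have "M \<ge> 0" unfolding M_def by (rule sum_nonneg) simp
  define \<gamma> where "\<gamma> = max (\<tau> + 1) (4 * M / c + 1)"
  have \<gamma>: "\<gamma> > \<tau>" "\<gamma> \<ge> 4 * M / c + 1" unfolding \<gamma>_def by auto
  have "0 \<le> 4 * M / c" using \<open>M \<ge> 0\<close> c by simp
  then have \<gamma>0: "\<gamma> > 0" using \<gamma>(2) by linarith
  have "4 * M / c \<le> \<gamma>" using \<gamma>(2) by simp
  then have large: "2 * M / \<gamma> \<le> c / 2" using c \<gamma>0 by (simp add: field_simps)
  have "\<exists>chi\<in>nonprincipal_characters q. K chi \<noteq> []"
  proof (rule ccontr)
    assume none: "\<not> (\<exists>chi\<in>nonprincipal_characters q. K chi \<noteq> [])"
    have "limit_gap q K a 1 = 0" for a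
      unfolding limit_gap_def using none by (intro sum.neutral) (simp add: harmonic_poly_def)
    then show False using pos[of 1] by simp
  qed
  then obtain chi where chi: "chi \<in> nonprincipal_characters q" "K chi \<noteq> []" by blast
  have R: "real_of_ereal (R_minus q (harmonic_system K \<gamma>)) = 3 / 4"
    by (simp add: R_harmonic_system[where K = K, OF chi])
  have ev: "\<forall>\<^sub>F x in at_top. (\<exists>a\<in>D. F a x < F 1 x) \<and> (\<exists>a\<in>D. F 1 x < F a x)"
    if F: "similar q (3 / 4) F (P_fun q (harmonic_system K \<gamma>))" for F
  proof -
    have "\<forall>\<^sub>F x in at_top. \<forall>a\<in>D.
      (c \<le> Im (limit_gap q K a (cis (\<gamma> * ln x))) \<longrightarrow> F a x < F 1 x) \<and>
      (Im (limit_gap q K a (cis (\<gamma> * ln x))) \<le> - c \<longrightarrow> F 1 x < F a x)"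
    proof (rule eventually_ball_finite[OF fin], rule ballI)
      fix a assume "a \<in> D"
      then have "a \<in> totatives q" using D by blast
      from eventually_sign_of_limit_gap[where K = K, OF q \<gamma>0 K this c large[unfolded M_def] F]
      show "\<forall>\<^sub>F x in at_top.
        (c \<le> Im (limit_gap q K a (cis (\<gamma> * ln x))) \<longrightarrow> F a x < F 1 x) \<and>
        (Im (limit_gap q K a (cis (\<gamma> * ln x))) \<le> - c \<longrightarrow> F 1 x < F a x)" .
    qed
    then show ?thesis
    proof eventually_elim
      case (elim x)
      have w: "cis (\<gamma> * ln x) \<in> sphere 0 1" by simp
      obtain a where a: "a \<in> D" "c1 \<le> Im (limit_gap q K a (cis (\<gamma> * ln x)))"
        using c1(2)[OF w] by blast
      obtain b where b: "b \<in> D" "c2 \<le> - Im (limit_gap q K b (cis (\<gamma> * ln x)))"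
        using c2(2)[OF w] by blast
      have "c \<le> Im (limit_gap q K a (cis (\<gamma> * ln x)))"
        "Im (limit_gap q K b (cis (\<gamma> * ln x))) \<le> - c" using a(2) b(2) unfolding c_def by linarith+
      then show ?case using elim a(1) b(1) by blast
    qed
  qed
  show thesis
  proof (rule that[OF \<gamma>(1) \<gamma>0 is_system_harmonic_system[where K = K, OF q \<gamma>0 K chi]])
    show "barrier q (harmonic_system K \<gamma>) (\<lambda>F. for_arbitrarily_large (\<lambda>x. \<forall>a\<in>D. F 1 x < F a x))"
      unfolding barrier_def R
    proof (intro allI impI not_for_arbitrarily_large)
      fix F assume "similar q (3 / 4) F (P_fun q (harmonic_system K \<gamma>))"
      from ev[OF this] show "\<forall>\<^sub>F x in at_top. \<not> (\<forall>a\<in>D. F 1 x < F a x)"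
        by (rule eventually_mono) (use less_asym in blast)
    qed
    show "barrier q (harmonic_system K \<gamma>) (\<lambda>F. for_arbitrarily_large (\<lambda>x. \<forall>a\<in>D. F 1 x > F a x))"
      unfolding barrier_def R
    proof (intro allI impI not_for_arbitrarily_large)
      fix F assume "similar q (3 / 4) F (P_fun q (harmonic_system K \<gamma>))"
      from ev[OF this] show "\<forall>\<^sub>F x in at_top. \<not> (\<forall>a\<in>D. F 1 x > F a x)"
        by (rule eventually_mono) (use less_asym in blast)
    qed
  qed
qed

section \<open>Proof of the theorem\<close>

theorem theorem3p11:
  fixes q :: nat
  assumes "q \<ge> 7" and "q \<notin> {8, 10, 12, 24}"
  shows "\<exists>D. D \<subseteq> totatives q - {1} \<and> card D = 3 \<and>
    (\<forall>\<tau>::real. \<tau> > 0 \<longrightarrow>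
      (\<exists>B. is_system q B \<and> finite_system q B \<and> system_size q B \<le> 34 \<and>
        (\<forall>chi\<in>nonprincipal_characters q. \<forall>\<rho>\<in>seq_elems (B chi). Im \<rho> > \<tau>) \<and>
        barrier q B (\<lambda>F. for_arbitrarily_large (\<lambda>x. \<forall>a\<in>D. F 1 x < F a x)) \<and>
        barrier q B (\<lambda>F. for_arbitrarily_large (\<lambda>x. \<forall>a\<in>D. F 1 x > F a x))))"
proof -
  obtain chi psi a1 a2 a3 where chi: "dirichlet_character q chi" and psi: "dirichlet_character q psi"
    and tot: "{a1, a2, a3} \<subseteq> totatives q" and v1: "chi a1 = 1" "psi a1 = -1"
    and v3: "chi a3 = cnj (chi a2)" "psi a3 = cnj (psi a2)"
    and v2: "(psi a2 = 1 \<and> chi a2 \<noteq> 1 \<and> - 1 / 2 \<le> Re (chi a2)) \<or> (chi a2)\<^sup>2 = -1"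
    using race_configuration[OF assms] by metis
  define D where "D = {a1, a2, a3}"
  have q0: "q > 0" using assms by simp
  have norm: "norm (chi a2) = 1" "norm (psi a2) = 1"
    using tot dirichlet_character_norm[OF q0] chi psi by (auto simp: totatives_def)
  have real: "chi a2 \<noteq> cnj (chi a2)"
  proof
    assume "chi a2 = cnj (chi a2)"
    then have Im: "Im (chi a2) = 0" by (simp add: complex_eq_iff)
    then have "\<bar>Re (chi a2)\<bar> = 1" using norm(1) by (simp add: cmod_def)
    then have "Re (chi a2) = 1 \<or> Re (chi a2) = -1" by linarith
    then have "chi a2 = 1 \<or> chi a2 = -1" using Im by (auto simp: complex_eq_iff)
    then show False using v2 by auto
  qed
  then have "chi a2 \<noteq> 1" by auto
  have D: "D \<subseteq> totatives q - {1}"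
    using tot v1(2) v3(1) \<open>chi a2 \<noteq> 1\<close> dirichlet_character_one[OF chi] dirichlet_character_one[OF psi]
    unfolding D_def by auto
  have card: "card D = 3"
    using v1(1) v3(1) \<open>chi a2 \<noteq> 1\<close> real unfolding D_def by (auto simp: card_insert_if)
  define K where "K = (\<lambda>_. [])(chi := replicate 12 1, psi := odd_harmonics)"
  have ne: "chi \<noteq> psi" using v1 by auto
  have NP: "chi \<in> nonprincipal_characters q" "psi \<in> nonprincipal_characters q"
    using chi psi v1(2) \<open>chi a2 \<noteq> 1\<close> tot by (auto simp: nonprincipal_characters_def principal_character_def totatives_def)
  have NP_sum: "(\<Sum>eta\<in>nonprincipal_characters q. f eta) = f chi + f psi"
    if "\<And>eta. eta \<noteq> chi \<Longrightarrow> eta \<noteq> psi \<Longrightarrow> f eta = 0" for f :: "_ \<Rightarrow> 'b :: comm_monoid_add"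
  proof -
    have "(\<Sum>eta\<in>nonprincipal_characters q. f eta) = (\<Sum>eta\<in>{chi, psi}. f eta)"
      using that NP finite_nonprincipal_characters[OF q0] by (intro sum.mono_neutral_right) auto
    then show ?thesis using ne by simp
  qed
  have K0: "0 \<notin> set (K eta)" for eta
    by (simp add: K_def odd_harmonics_def)
  have gap: "limit_gap q K a w = race_gap (chi a) (psi a) w" for a w
  proof -
    have "limit_gap q K a w = (cnj (chi a) - 1) * harmonic_poly (K chi) w
        + (cnj (psi a) - 1) * harmonic_poly (K psi) w"
      unfolding limit_gap_def by (rule NP_sum) (simp add: K_def harmonic_poly_def)
    moreover have "harmonic_poly (replicate 12 1) w = 12 * w"
      by (simp add: harmonic_poly_def sum_list_replicate)
    ultimately show ?thesis using ne by (simp add: race_gap_def K_def)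
  qed
  have gapD: "limit_gap q K a1 w = race_gap 1 (-1) w" "limit_gap q K a2 w = race_gap (chi a2) (psi a2) w"
    "limit_gap q K a3 w = race_gap (cnj (chi a2)) (cnj (psi a2)) w" for w
    by (simp_all only: gap v1 v3)
  have pos: "\<exists>a\<in>D. 0 < Im (limit_gap q K a w)" if "norm w = 1" for w
    using race_gap_pos[OF that norm v2] unfolding D_def gapD[symmetric] by blast
  have neg: "\<exists>a\<in>D. Im (limit_gap q K a w) < 0" if "norm w = 1" for w
    using race_gap_neg[OF that norm v2] unfolding D_def gapD[symmetric] by blast
  have size: "system_size q (harmonic_system K \<gamma>) = 24" for \<gamma>
  proof -
    have "system_size q (harmonic_system K \<gamma>) = length (K chi) + length (K psi)"
      unfolding system_size_def harmonic_system_def seq_length.simps length_map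
      by (rule NP_sum) (simp add: K_def)
    then show ?thesis using ne by (simp add: K_def odd_harmonics_def)
  qed
  have finite: "finite_system q (harmonic_system K \<gamma>)" for \<gamma>
    by (simp add: finite_system_def harmonic_system_def)
  have Im: "Im \<rho> > \<tau>" if "\<rho> \<in> seq_elems (harmonic_system K \<gamma> eta)" "\<gamma> > \<tau>" "\<gamma> > 0" for \<rho> \<gamma> \<tau> eta
  proof -
    from that(1) obtain k where k: "k \<in> set (K eta)" "\<rho> = harmonic_zero \<gamma> k"
      by (auto simp: harmonic_system_def)
    then have "1 \<le> real k" using K0[of eta] by (cases "k = 0") auto
    then have "1 * \<gamma> \<le> real k * \<gamma>" using that(3) by (intro mult_right_mono) auto
    then show ?thesis using k(2) that(2) by (simp add: harmonic_zero_def)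
  qed
  show ?thesis
  proof (intro exI[of _ D] conjI allI impI D card)
    fix \<tau> :: real
    have "D \<subseteq> totatives q" using D by blast
    obtain \<gamma> where \<gamma>: "\<gamma> > \<tau>" "\<gamma> > 0" "is_system q (harmonic_system K \<gamma>)"
      "barrier q (harmonic_system K \<gamma>) (\<lambda>F. for_arbitrarily_large (\<lambda>x. \<forall>a\<in>D. F 1 x < F a x))"
      "barrier q (harmonic_system K \<gamma>) (\<lambda>F. for_arbitrarily_large (\<lambda>x. \<forall>a\<in>D. F 1 x > F a x))"
      by (rule harmonic_system_barrier[where K = K and \<tau> = \<tau>, OF q0 K0 \<open>D \<subseteq> totatives q\<close> pos neg])
    show "\<exists>B. is_system q B \<and> finite_system q B \<and> system_size q B \<le> 34 \<and>
        (\<forall>chi\<in>nonprincipal_characters q. \<forall>\<rho>\<in>seq_elems (B chi). Im \<rho> > \<tau>) \<and>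
        barrier q B (\<lambda>F. for_arbitrarily_large (\<lambda>x. \<forall>a\<in>D. F 1 x < F a x)) \<and>
        barrier q B (\<lambda>F. for_arbitrarily_large (\<lambda>x. \<forall>a\<in>D. F 1 x > F a x))"
    proof (intro exI[of _ "harmonic_system K \<gamma>"] conjI ballI \<gamma>(3-5) finite)
      show "system_size q (harmonic_system K \<gamma>) \<le> 34" by (simp add: size)
    qed (rule Im[OF _ \<gamma>(1,2)])
  qed
qed

end
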